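(* Let $\mathcal{M}$ be a semi-finite von Neumann algebra, and let $\Delta : \mathcal{M} \to \mathcal{M}$ be a 2-local derivation (not assumed to be linear). Then $\Delta$ is a derivation.
   Context: Let $\mathcal{M}$ be a von Neumann algebra. A derivation on $\mathcal{M}$ is a (complex-)linear map $D : \mathcal{M} \to \mathcal{M}$ such that $D(xy) = D(x)y + xD(y)$ for all $x, y \in \mathcal{M}$. A map $\Delta : \mathcal{M} \to \mathcal{M}$ (not linear in general) is called a 2-local derivation if for any two elements $x, y \in \mathcal{M}$ there exists a derivation $D_{x,y} : \mathcal{M} \to \mathcal{M}$ (depending on $x$ and $y$) such that $\Delta(x) = D_{x,y}(x)$ and $\Delta(y) = D_{x,y}(y)$. A von Neumann algebra is semi-finite if it admits a faithful normal semi-finite trace. *)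

theory Defs
  imports "HOL-Analysis.Analysis"
begin

section \<open>Complex Hilbert spaces\<close>

text \<open>The inner product is linear in its first argument.\<close>

class complex_inner = real_normed_vector +
  fixes scaleC :: "complex \<Rightarrow> 'a \<Rightarrow> 'a" (infixr \<open>*\<^sub>C\<close> 75)
    and cinner :: "'a \<Rightarrow> 'a \<Rightarrow> complex"
  assumes scaleC_add_right: "c *\<^sub>C (x + y) = c *\<^sub>C x + c *\<^sub>C y"
    and scaleC_add_left: "(c + d) *\<^sub>C x = c *\<^sub>C x + d *\<^sub>C x"
    and scaleC_scaleC: "c *\<^sub>C d *\<^sub>C x = (c * d) *\<^sub>C x"
    and scaleC_of_real: "complex_of_real r *\<^sub>C x = r *\<^sub>R x"
    and cinner_commute: "cinner x y = cnj (cinner y x)"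
    and cinner_add_left: "cinner (x + y) z = cinner x z + cinner y z"
    and cinner_scaleC_left: "cinner (c *\<^sub>C x) y = c * cinner x y"
    and cinner_ge_zero: "0 \<le> Re (cinner x x)"
    and norm_eq_sqrt_cinner: "norm x = sqrt (Re (cinner x x))"

class chilbert_space = complex_inner + complete_space

instantiation complex :: chilbert_space
begin

definition scaleC_complex :: "complex \<Rightarrow> complex \<Rightarrow> complex"
  where "scaleC_complex c x = c * x"

definition cinner_complex :: "complex \<Rightarrow> complex \<Rightarrow> complex"
  where "cinner_complex x y = x * cnj y"

instance
  by standard
    (auto simp: scaleC_complex_def cinner_complex_def algebra_simps scaleR_conv_of_real
      cmod_def power2_eq_square)

end

lemma norm_scaleC: "norm (c *\<^sub>C x) = cmod c * norm (x :: 'a::complex_inner)"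
proof -
  have "cinner (c *\<^sub>C x) (c *\<^sub>C x) = c * cnj (c * cinner x x)"
    by (metis cinner_commute cinner_scaleC_left)
  also have "\<dots> = (c * cnj c) * cinner x x"
    by (simp flip: cinner_commute)
  also have "\<dots> = complex_of_real ((cmod c)\<^sup>2) * cinner x x"
    by (simp only: complex_norm_square)
  finally have "Re (cinner (c *\<^sub>C x) (c *\<^sub>C x)) = (cmod c)\<^sup>2 * Re (cinner x x)"
    by simp
  then show ?thesis
    by (simp add: norm_eq_sqrt_cinner[where 'a='a] real_sqrt_mult)
qed

lemma bounded_linear_scaleC: "bounded_linear (\<lambda>x::'a::complex_inner. c *\<^sub>C x)"
proof (rule bounded_linear_intro)
  fix x y :: 'a and r :: real
  show "c *\<^sub>C (x + y) = c *\<^sub>C x + c *\<^sub>C y"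
    by (rule scaleC_add_right)
  show "c *\<^sub>C r *\<^sub>R x = r *\<^sub>R c *\<^sub>C x"
    by (metis scaleC_of_real scaleC_scaleC mult.commute)
  show "norm (c *\<^sub>C x) \<le> norm x * cmod c"
    by (simp add: norm_scaleC)
qed


section \<open>Bounded operators\<close>

text \<open>
  The type \<open>'a \<Rightarrow>\<^sub>L 'a\<close> consists of the bounded real-linear operators; the operators of
  complex Hilbert space theory are its complex-linear members.
\<close>

definition bounded_ops :: "('a::complex_inner \<Rightarrow>\<^sub>L 'a) set"
  where "bounded_ops = {T. \<forall>c x. blinfun_apply T (c *\<^sub>C x) = c *\<^sub>C blinfun_apply T x}"

lift_definition scaleC_op :: "complex \<Rightarrow> ('a::complex_inner \<Rightarrow>\<^sub>L 'a) \<Rightarrow> ('a \<Rightarrow>\<^sub>L 'a)"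
  is "\<lambda>c T x. c *\<^sub>C T x"
  by (rule bounded_linear_compose[OF bounded_linear_scaleC])

definition is_adjoint :: "('a::complex_inner \<Rightarrow>\<^sub>L 'a) \<Rightarrow> ('a \<Rightarrow>\<^sub>L 'a) \<Rightarrow> bool"
  where "is_adjoint T S \<longleftrightarrow> (\<forall>x y. cinner (blinfun_apply T x) y = cinner x (blinfun_apply S y))"

definition positive_op :: "('a::complex_inner \<Rightarrow>\<^sub>L 'a) \<Rightarrow> bool"
  where "positive_op T \<longleftrightarrow> (\<forall>x. cinner (blinfun_apply T x) x \<in> \<real>\<^sub>\<ge>\<^sub>0)"

definition op_le :: "('a::complex_inner \<Rightarrow>\<^sub>L 'a) \<Rightarrow> ('a \<Rightarrow>\<^sub>L 'a) \<Rightarrow> bool"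
  where "op_le S T \<longleftrightarrow> positive_op (T - S)"


section \<open>Von Neumann algebras\<close>

definition commutant :: "('a::complex_inner \<Rightarrow>\<^sub>L 'a) set \<Rightarrow> ('a \<Rightarrow>\<^sub>L 'a) set"
  where "commutant M = {S \<in> bounded_ops. \<forall>T\<in>M. S o\<^sub>L T = T o\<^sub>L S}"

text \<open>
  A self-adjoint set of operators that equals its bicommutant; being a unital complex
  subalgebra is then automatic (see below).
\<close>

definition von_neumann_algebra :: "('a::chilbert_space \<Rightarrow>\<^sub>L 'a) set \<Rightarrow> bool"
  where "von_neumann_algebra M \<longleftrightarrow>
    M \<subseteq> bounded_ops \<and>
    (\<forall>T\<in>M. \<exists>S\<in>M. is_adjoint T S) \<and>
    commutant (commutant M) = M"

lemma mem_commutant_iff: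
  "S \<in> commutant M \<longleftrightarrow> S \<in> bounded_ops \<and>
    (\<forall>T\<in>M. \<forall>x. blinfun_apply S (blinfun_apply T x) = blinfun_apply T (blinfun_apply S x))"
  unfolding commutant_def
  by (auto intro!: blinfun_eqI) (metis blinfun_apply_blinfun_compose)

lemma commutant_subalgebra:
  fixes M :: "('a::complex_inner \<Rightarrow>\<^sub>L 'a) set"
  assumes "M \<subseteq> bounded_ops"
  shows "id_blinfun \<in> commutant M"
    and "\<lbrakk>S \<in> commutant M; T \<in> commutant M\<rbrakk> \<Longrightarrow> S + T \<in> commutant M"
    and "\<lbrakk>S \<in> commutant M; T \<in> commutant M\<rbrakk> \<Longrightarrow> S o\<^sub>L T \<in> commutant M"
    and "S \<in> commutant M \<Longrightarrow> scaleC_op c S \<in> commutant M"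
  using assms
  by (auto simp: mem_commutant_iff bounded_ops_def blinfun.add_left blinfun.add_right
      scaleC_add_right scaleC_op.rep_eq scaleC_scaleC mult.commute subset_iff)

lemma von_neumann_algebra_subalgebra:
  assumes "von_neumann_algebra M"
  shows "id_blinfun \<in> M"
    and "\<lbrakk>S \<in> M; T \<in> M\<rbrakk> \<Longrightarrow> S + T \<in> M"
    and "\<lbrakk>S \<in> M; T \<in> M\<rbrakk> \<Longrightarrow> S o\<^sub>L T \<in> M"
    and "S \<in> M \<Longrightarrow> scaleC_op c S \<in> M"
proof -
  have "commutant M \<subseteq> bounded_ops" "commutant (commutant M) = M"
    using assms by (auto simp: von_neumann_algebra_def commutant_def)
  then show "id_blinfun \<in> M"
    and "\<lbrakk>S \<in> M; T \<in> M\<rbrakk> \<Longrightarrow> S + T \<in> M"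
    and "\<lbrakk>S \<in> M; T \<in> M\<rbrakk> \<Longrightarrow> S o\<^sub>L T \<in> M"
    and "S \<in> M \<Longrightarrow> scaleC_op c S \<in> M"
    using commutant_subalgebra[of "commutant M"] by simp_all
qed

definition positive_part :: "('a::complex_inner \<Rightarrow>\<^sub>L 'a) set \<Rightarrow> ('a \<Rightarrow>\<^sub>L 'a) set"
  where "positive_part M = {T \<in> M. positive_op T}"


section \<open>Traces and semi-finiteness\<close>

text \<open>
  A trace is defined on the positive part of the algebra only; its values elsewhere are
  irrelevant. In \<^typ>\<open>ennreal\<close>, \<open>0 * \<infinity> = 0\<close>.
\<close>

definition is_trace :: "('a::complex_inner \<Rightarrow>\<^sub>L 'a) set \<Rightarrow> (('a \<Rightarrow>\<^sub>L 'a) \<Rightarrow> ennreal) \<Rightarrow> bool"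
  where "is_trace M \<tau> \<longleftrightarrow>
    (\<forall>S\<in>positive_part M. \<forall>T\<in>positive_part M. \<tau> (S + T) = \<tau> S + \<tau> T) \<and>
    (\<forall>T\<in>positive_part M. \<forall>r\<ge>0. \<tau> (r *\<^sub>R T) = ennreal r * \<tau> T) \<and>
    (\<forall>T\<in>M. \<forall>S\<in>M. is_adjoint T S \<longrightarrow> \<tau> (S o\<^sub>L T) = \<tau> (T o\<^sub>L S))"

definition faithful_trace :: "('a::complex_inner \<Rightarrow>\<^sub>L 'a) set \<Rightarrow> (('a \<Rightarrow>\<^sub>L 'a) \<Rightarrow> ennreal) \<Rightarrow> bool"
  where "faithful_trace M \<tau> \<longleftrightarrow> (\<forall>T\<in>positive_part M. \<tau> T = 0 \<longrightarrow> T = 0)"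

definition op_directed :: "('a::complex_inner \<Rightarrow>\<^sub>L 'a) set \<Rightarrow> bool"
  where "op_directed F \<longleftrightarrow> F \<noteq> {} \<and> (\<forall>S\<in>F. \<forall>T\<in>F. \<exists>U\<in>F. op_le S U \<and> op_le T U)"

definition is_op_lub ::
    "('a::complex_inner \<Rightarrow>\<^sub>L 'a) set \<Rightarrow> ('a \<Rightarrow>\<^sub>L 'a) set \<Rightarrow> ('a \<Rightarrow>\<^sub>L 'a) \<Rightarrow> bool"
  where "is_op_lub M F S \<longleftrightarrow>
    S \<in> M \<and> (\<forall>T\<in>F. op_le T S) \<and> (\<forall>U\<in>M. (\<forall>T\<in>F. op_le T U) \<longrightarrow> op_le S U)"

text \<open>Upward directed subsets play the role of increasing nets.\<close>

definition normal_trace :: "('a::complex_inner \<Rightarrow>\<^sub>L 'a) set \<Rightarrow> (('a \<Rightarrow>\<^sub>L 'a) \<Rightarrow> ennreal) \<Rightarrow> bool"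
  where "normal_trace M \<tau> \<longleftrightarrow>
    (\<forall>F S. F \<subseteq> positive_part M \<longrightarrow> op_directed F \<longrightarrow> is_op_lub M F S \<longrightarrow> \<tau> S = (SUP T\<in>F. \<tau> T))"

definition semifinite_trace :: "('a::complex_inner \<Rightarrow>\<^sub>L 'a) set \<Rightarrow> (('a \<Rightarrow>\<^sub>L 'a) \<Rightarrow> ennreal) \<Rightarrow> bool"
  where "semifinite_trace M \<tau> \<longleftrightarrow>
    (\<forall>T\<in>positive_part M. T \<noteq> 0 \<longrightarrow>
      (\<exists>S\<in>positive_part M. S \<noteq> 0 \<and> op_le S T \<and> \<tau> S < \<infinity>))"

definition semifinite_von_neumann_algebra :: "('a::chilbert_space \<Rightarrow>\<^sub>L 'a) set \<Rightarrow> bool"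
  where "semifinite_von_neumann_algebra M \<longleftrightarrow>
    von_neumann_algebra M \<and>
    (\<exists>\<tau>. is_trace M \<tau> \<and> faithful_trace M \<tau> \<and> normal_trace M \<tau> \<and> semifinite_trace M \<tau>)"


section \<open>Derivations and 2-local derivations\<close>

text \<open>Maps on \<open>M\<close> are total functions of which only the values on \<open>M\<close> matter.\<close>

definition derivation_on ::
    "('a::complex_inner \<Rightarrow>\<^sub>L 'a) set \<Rightarrow> (('a \<Rightarrow>\<^sub>L 'a) \<Rightarrow> ('a \<Rightarrow>\<^sub>L 'a)) \<Rightarrow> bool"
  where "derivation_on M D \<longleftrightarrow>
    D \<in> M \<rightarrow> M \<and>
    (\<forall>x\<in>M. \<forall>y\<in>M. D (x + y) = D x + D y) \<and>
    (\<forall>c. \<forall>x\<in>M. D (scaleC_op c x) = scaleC_op c (D x)) \<and>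
    (\<forall>x\<in>M. \<forall>y\<in>M. D (x o\<^sub>L y) = (D x o\<^sub>L y) + (x o\<^sub>L D y))"

definition two_local_derivation_on ::
    "('a::complex_inner \<Rightarrow>\<^sub>L 'a) set \<Rightarrow> (('a \<Rightarrow>\<^sub>L 'a) \<Rightarrow> ('a \<Rightarrow>\<^sub>L 'a)) \<Rightarrow> bool"
  where "two_local_derivation_on M \<Delta> \<longleftrightarrow>
    \<Delta> \<in> M \<rightarrow> M \<and>
    (\<forall>x\<in>M. \<forall>y\<in>M. \<exists>D. derivation_on M D \<and> \<Delta> x = D x \<and> \<Delta> y = D y)"

end

theory Submission
  imports Defs
begin

text \<open>
  For a projection \<open>e\<close> of finite trace, \<open>f x = \<tau> (e x e)\<close> is a bounded functional with
  \<open>f (x e y) = f (y e x)\<close>. If \<open>D\<close> is a derivation and \<open>u\<close> a unitary commuting with \<open>e\<close>, then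
  \<open>f (D (u\<^sup>n) u\<^sup>-\<^sup>n) = n f (D u u\<^sup>-\<^sup>1)\<close>; as \<open>D\<close> is bounded, this forces \<open>f (D u u\<^sup>-\<^sup>1) = 0\<close>, and
  taking for \<open>u\<close> a unitary \<open>r h + i sqrt (1 - r\<^sup>2 h\<^sup>2)\<close> and letting \<open>r\<close> tend to 0 yields
  \<open>f (D z) = 0\<close> for \<open>z = e z e\<close>, without using that derivations are inner. Consequently
  \<open>f (D x w)\<close>, for \<open>w = e w e\<close>, depends on \<open>D\<close> only through \<open>D w\<close>, and linearly on \<open>x\<close>. Since
  a 2-local derivation \<open>\<Delta>\<close> agrees with some derivation at both \<open>x\<close> and \<open>w\<close>, also \<open>f (\<Delta> x w)\<close>
  is linear in \<open>x\<close>; semi-finiteness and faithfulness of the trace give additivity of \<open>\<Delta>\<close>.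
  An additive 2-local derivation is a Jordan derivation, and these are derivations because the
  algebra is semiprime.
\<close>


section \<open>Jordan derivations\<close>

text \<open>Additivity relates \<open>\<Delta>\<close> at three points, whereas one derivation
  controls it at two. So \<open>\<Delta> x\<close> is paired with a fixed test element
  \<open>w\<close> and the derivative is shifted to \<open>w\<close>. The obstacle is that a
  derivation moves \<open>e\<close>: it does not preserve the corner \<open>e A e\<close>, and
  \<open>x * w\<close> lies in that corner only on its right side. The resulting term in
  \<open>D e\<close> is recovered from \<open>D w\<close> by differentiating
  \<open>w = w * e\<close>.

  Boundedness of derivations is proved here as well. The real part of \<open>D\<close> is
  dissipative on self-adjoint elements, because \<open>D\<close> applied to a square
  \<open>h * h\<close> gives a form that is small at vectors which \<open>h\<close> almost kills; an
  everywhere defined dissipative map is bounded by Baire's theorem. Square roots come from an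
  iteration that stays inside the algebra, and spectral projections from strong limits of powers, so
  no functional calculus is developed.\<close>

locale semiprime_subring =
  fixes A :: "'r::real_algebra set"
  assumes add_closed: "x \<in> A \<Longrightarrow> y \<in> A \<Longrightarrow> x + y \<in> A"
    and minus_closed: "x \<in> A \<Longrightarrow> - x \<in> A"
    and mult_closed: "x \<in> A \<Longrightarrow> y \<in> A \<Longrightarrow> x * y \<in> A"
    and semiprime: "x \<in> A \<Longrightarrow> (\<And>z. z \<in> A \<Longrightarrow> x * z * x = 0) \<Longrightarrow> x = 0"
    and has_unit: "\<exists>e\<in>A. \<forall>x. x * e = x \<and> e * x = x"
begin

lemma diff_closed: "x \<in> A \<Longrightarrow> y \<in> A \<Longrightarrow> x - y \<in> A"
  using add_closed[of x "- y"] minus_closed[of y] by simp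

lemma double_zero: "(x::'r) + x = 0 \<Longrightarrow> x = 0"
  by (metis scaleR_2 scaleR_eq_0_iff zero_neq_numeral)

lemma double_cancel: "(x::'r) + x = y + y \<Longrightarrow> x = y"
  by (metis scaleR_2 scaleR_left_imp_eq zero_neq_numeral)

text \<open>Put \<open>t = a * z * b\<close>. The hypothesis exchanges the outer factors
  \<open>a\<close> and \<open>b\<close> of a product at the price of a sign. Three such exchanges
  carry \<open>t * w * t\<close> back to itself, so it equals its own negative.\<close>

lemma swap_zero:
  assumes "a \<in> A" "b \<in> A" and sw: "\<And>z. z \<in> A \<Longrightarrow> a * z * b + b * z * a = 0" and z: "z \<in> A"
  shows "a * z * b = 0"
proof (rule semiprime)
  show "a * z * b \<in> A"
    by (intro mult_closed assms)
  fix w assume w: "w \<in> A"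
  have s: "b * y * a = - (a * y * b)" if "y \<in> A" for y
    using sw[OF that] by (simp add: eq_neg_iff_add_eq_0 add.commute)
  have zw: "z * a * w \<in> A" "z * b * w \<in> A" "w * b * z \<in> A" "a * w * b \<in> A" "b * w * a \<in> A"
      "z * a * w * b * z \<in> A"
    by (intro mult_closed assms w)+
  have "a * z * b * w * (a * z * b) = - (b * z * a) * w * (a * z * b)"
    using s[OF z] by simp
  also have "\<dots> = - (b * (z * a * w) * a) * z * b"
    by (simp add: mult.assoc)
  also have "\<dots> = a * (z * a * w) * b * z * b"
    using s[OF zw(1)] by simp
  also have "\<dots> = a * z * (a * w * b) * z * b"
    by (simp add: mult.assoc)
  also have "\<dots> = - (a * z * (b * w * a) * z * b)"
    using s[OF w] by simp
  also have "\<dots> = - (a * z * b * w * (a * z * b))"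
    by (simp add: mult.assoc)
  finally have "a * z * b * w * (a * z * b) + a * z * b * w * (a * z * b) = 0"
    by (simp only: eq_neg_iff_add_eq_0)
  then show "a * z * b * w * (a * z * b) = 0"
    by (rule double_zero)
qed

lemma flip_zero:
  assumes "a \<in> A" "b \<in> A" "\<And>z. z \<in> A \<Longrightarrow> a * z * b = 0" "z \<in> A"
  shows "b * z * a = 0"
proof (rule semiprime)
  show "b * z * a \<in> A"
    by (intro mult_closed assms)
  fix w assume w: "w \<in> A"
  have "b * z * a * w * (b * z * a) = b * z * (a * w * b) * z * a"
    by (simp add: mult.assoc)
  then show "b * z * a * w * (b * z * a) = 0"
    using assms(3)[OF w] by simp
qed

text \<open>The classical result for 2-torsion-free semiprime rings, in the unital case over the
  reals. The defect \<open>B\<close> of the Leibniz rule is biadditive and antisymmetric; it turns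
  out to annihilate all commutators, which makes each of its values central and nilpotent, and a
  semiprime ring has no such element except 0.\<close>

theorem jordan_derivation_is_derivation:
  fixes \<delta> :: "'r \<Rightarrow> 'r"
  assumes map: "\<And>x. x \<in> A \<Longrightarrow> \<delta> x \<in> A"
    and add: "\<And>x y. x \<in> A \<Longrightarrow> y \<in> A \<Longrightarrow> \<delta> (x + y) = \<delta> x + \<delta> y"
    and sq: "\<And>x. x \<in> A \<Longrightarrow> \<delta> (x * x) = \<delta> x * x + x * \<delta> x"
    and x: "x \<in> A" and y: "y \<in> A"
  shows "\<delta> (x * y) = \<delta> x * y + x * \<delta> y"
proof -
  note cl = add_closed mult_closed map diff_closed
  define B where "B x y = \<delta> (x * y) - \<delta> x * y - x * \<delta> y" for x y
  have jp: "\<delta> (x * y + y * x) = \<delta> x * y + x * \<delta> y + \<delta> y * x + y * \<delta> x"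
    if "x \<in> A" "y \<in> A" for x y
  proof -
    have "(x + y) * (x + y) = x * x + (x * y + y * x) + y * y"
      by (simp add: algebra_simps)
    then have "\<delta> ((x + y) * (x + y)) = \<delta> (x * x) + \<delta> (x * y + y * x) + \<delta> (y * y)"
      using that by (simp add: add cl)
    moreover have "\<delta> ((x + y) * (x + y)) = (\<delta> x + \<delta> y) * (x + y) + (x + y) * (\<delta> x + \<delta> y)"
      using that by (simp add: add sq cl)
    ultimately show ?thesis
      using that by (simp add: sq algebra_simps)
  qed
  have tr: "\<delta> (x * y * x) = \<delta> x * y * x + x * \<delta> y * x + x * y * \<delta> x"
    if "x \<in> A" "y \<in> A" for x y
  proof -
    \<comment> \<open>Applying \<open>jp\<close> on both sides leaves
      \<open>\<delta> (x * y * x)\<close> twice as the only unknown, hence the division by 2 at the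
      end.\<close>
    have e: "x * (x * y + y * x) + (x * y + y * x) * x = (x * x * y + y * (x * x)) + (x * y * x + x * y * x)"
      by (simp add: algebra_simps)
    have "\<delta> (x * (x * y + y * x) + (x * y + y * x) * x) =
       \<delta> x * (x * y + y * x) + x * (\<delta> x * y + x * \<delta> y + \<delta> y * x + y * \<delta> x)
       + (\<delta> x * y + x * \<delta> y + \<delta> y * x + y * \<delta> x) * x + (x * y + y * x) * \<delta> x"
      using that by (simp add: jp cl)
    moreover have "\<delta> (x * x * y + y * (x * x) + (x * y * x + x * y * x)) =
      (\<delta> x * x + x * \<delta> x) * y + x * x * \<delta> y + \<delta> y * (x * x) + y * (\<delta> x * x + x * \<delta> x)
      + (\<delta> (x * y * x) + \<delta> (x * y * x))"
      using that by (simp add: jp cl add[of "x * x * y + y * (x * x)"] add[of "x * y * x"] sq)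
    ultimately have "\<delta> (x * y * x) + \<delta> (x * y * x) =
       \<delta> x * (x * y + y * x) + x * (\<delta> x * y + x * \<delta> y + \<delta> y * x + y * \<delta> x)
       + (\<delta> x * y + x * \<delta> y + \<delta> y * x + y * \<delta> x) * x + (x * y + y * x) * \<delta> x
       - ((\<delta> x * x + x * \<delta> x) * y + x * x * \<delta> y + \<delta> y * (x * x) + y * (\<delta> x * x + x * \<delta> x))"
      unfolding e by (simp only: eq_diff_eq add.commute)
    also have "\<dots> = (\<delta> x * y * x + x * \<delta> y * x + x * y * \<delta> x) + (\<delta> x * y * x + x * \<delta> y * x + x * y * \<delta> x)"
      by (simp add: algebra_simps)
    finally show ?thesis
      by (rule double_cancel)
  qed
  have tr2: "\<delta> (x * y * z + z * y * x) = \<delta> x * y * z + x * \<delta> y * z + x * y * \<delta> z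
      + \<delta> z * y * x + z * \<delta> y * x + z * y * \<delta> x"
    if "x \<in> A" "y \<in> A" "z \<in> A" for x y z
  proof -
    have e: "(x + z) * y * (x + z) = x * y * x + (x * y * z + z * y * x) + z * y * z"
      by (simp add: algebra_simps)
    have "\<delta> ((x + z) * y * (x + z)) =
       (\<delta> x + \<delta> z) * y * (x + z) + (x + z) * \<delta> y * (x + z) + (x + z) * y * (\<delta> x + \<delta> z)"
      using that by (simp add: tr add cl)
    moreover have "\<delta> (x * y * x + (x * y * z + z * y * x) + z * y * z)
      = \<delta> (x * y * x) + \<delta> (x * y * z + z * y * x) + \<delta> (z * y * z)"
      using that by (simp add: add cl)
    ultimately have "\<delta> (x * y * z + z * y * x) =
       (\<delta> x + \<delta> z) * y * (x + z) + (x + z) * \<delta> y * (x + z) + (x + z) * y * (\<delta> x + \<delta> z)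
       - \<delta> (x * y * x) - \<delta> (z * y * z)"
      unfolding e by (simp only: eq_diff_eq add_ac)
    also have "\<dots> = \<delta> x * y * z + x * \<delta> y * z + x * y * \<delta> z
      + \<delta> z * y * x + z * \<delta> y * x + z * y * \<delta> x"
      unfolding tr[OF that(1,2)] tr[OF that(3,2)] by (simp add: algebra_simps)
    finally show ?thesis .
  qed
  have Bcl: "B x y \<in> A" if "x \<in> A" "y \<in> A" for x y
    unfolding B_def using that by (intro cl)
  have Banti: "B y x = - B x y" if "x \<in> A" "y \<in> A" for x y
  proof -
    have "\<delta> (x * y) + \<delta> (y * x) = \<delta> x * y + x * \<delta> y + \<delta> y * x + y * \<delta> x"
      using jp[OF that] that by (simp add: add cl)
    then show ?thesis
      unfolding B_def by (simp add: algebra_simps)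
  qed
  have Badd1: "B (x + u) y = B x y + B u y" if "x \<in> A" "y \<in> A" "u \<in> A" for x y u
    using that unfolding B_def by (simp add: add cl algebra_simps)
  have Badd2: "B x (y + u) = B x y + B x u" if "x \<in> A" "y \<in> A" "u \<in> A" for x y u
    using that unfolding B_def by (simp add: add cl algebra_simps)
  have comm: "x * y - y * x \<in> A" if "x \<in> A" "y \<in> A" for x y
    using that by (intro cl)
  have key: "B x y * z * (x * y - y * x) + (x * y - y * x) * z * B x y = 0"
    if xyz: "x \<in> A" "y \<in> A" "z \<in> A" for x y z
  proof -
    \<comment> \<open>On the left \<open>tr2\<close> treats \<open>x * y\<close> and
      \<open>y * x\<close> as single factors, on the right \<open>tr\<close> is applied twice,
      nested. The two values of \<open>\<delta>\<close> differ by terms in \<open>B\<close>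
      only.\<close>
    have e: "(x * y) * z * (y * x) + (y * x) * z * (x * y) = x * (y * z * y) * x + y * (x * z * x) * y"
      by (simp add: algebra_simps)
    have 1: "\<delta> ((x * y) * z * (y * x) + (y * x) * z * (x * y)) =
       \<delta> (x * y) * z * (y * x) + x * y * \<delta> z * (y * x) + x * y * z * \<delta> (y * x)
       + \<delta> (y * x) * z * (x * y) + y * x * \<delta> z * (x * y) + y * x * z * \<delta> (x * y)"
      using xyz by (intro tr2 cl)
    have "\<delta> (x * (y * z * y) * x) = \<delta> x * (y * z * y) * x + x * (\<delta> y * z * y + y * \<delta> z * y + y * z * \<delta> y) * x
         + x * (y * z * y) * \<delta> x" if "x \<in> A" "y \<in> A" for x y
      using that xyz(3) by (subst tr) (simp_all add: tr cl)
    with xyz have 2: "\<delta> (x * (y * z * y) * x + y * (x * z * x) * y) =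
       \<delta> x * (y * z * y) * x + x * (\<delta> y * z * y + y * \<delta> z * y + y * z * \<delta> y) * x
         + x * (y * z * y) * \<delta> x + (\<delta> y * (x * z * x) * y + y * (\<delta> x * z * x + x * \<delta> z * x + x * z * \<delta> x) * y
         + y * (x * z * x) * \<delta> y)"
      by (subst add) (simp_all add: cl)
    have "B x y * z * (y * x) + x * y * z * B y x + B y x * z * (x * y) + y * x * z * B x y
       = (\<delta> (x * y) * z * (y * x) + x * y * \<delta> z * (y * x) + x * y * z * \<delta> (y * x)
       + \<delta> (y * x) * z * (x * y) + y * x * \<delta> z * (x * y) + y * x * z * \<delta> (x * y))
       - (\<delta> x * (y * z * y) * x + x * (\<delta> y * z * y + y * \<delta> z * y + y * z * \<delta> y) * x
         + x * (y * z * y) * \<delta> x + (\<delta> y * (x * z * x) * y + y * (\<delta> x * z * x + x * \<delta> z * x + x * z * \<delta> x) * y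
         + y * (x * z * x) * \<delta> y))"
      unfolding B_def by (simp add: algebra_simps)
    also have "\<dots> = 0"
      using 1 2 unfolding e by simp
    finally have "B x y * z * (y * x) + x * y * z * B y x + B y x * z * (x * y) + y * x * z * B x y = 0" .
    then show ?thesis
      using xyz by (simp add: Banti[of x y] algebra_simps)
  qed
  have z1: "B x y * z * (x * y - y * x) = 0" if "x \<in> A" "y \<in> A" "z \<in> A" for x y z
    by (rule swap_zero) (use that key comm Bcl in auto)
  have z2: "B x y * z * (u * y - y * u) = 0" if m: "x \<in> A" "y \<in> A" "z \<in> A" "u \<in> A" for x y z u
  proof (rule semiprime)
    show "B x y * z * (u * y - y * u) \<in> A"
      using m by (intro mult_closed comm Bcl)
    fix w assume w: "w \<in> A"
    \<comment> \<open>Linearising \<open>z1\<close> in its first argument only shows that the two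
      mixed terms are negatives of each other. Replacing one of them in the product with
      \<open>w\<close> places \<open>(u * y - y * u) * w * B u y\<close> in the middle, which is
      zero. \<open>z3\<close> linearises the second argument in the same way.\<close>
    have "B (x + u) y * z * ((x + u) * y - y * (x + u)) = 0"
      using m by (intro z1 cl)
    then have "B x y * z * (x * y - y * x) + B x y * z * (u * y - y * u)
       + B u y * z * (x * y - y * x) + B u y * z * (u * y - y * u) = 0"
      using m by (simp add: Badd1 algebra_simps)
    then have e: "B x y * z * (u * y - y * u) = - (B u y * z * (x * y - y * x))"
      using m by (simp add: z1 eq_neg_iff_add_eq_0)
    have "(u * y - y * u) * w * B u y = 0"
      by (rule flip_zero) (use m w Bcl comm z1 in auto)
    then have "B x y * z * ((u * y - y * u) * w * B u y) * z * (x * y - y * x) = 0"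
      by simp
    then show "B x y * z * (u * y - y * u) * w * (B x y * z * (u * y - y * u)) = 0"
      by (subst (2) e) (simp add: mult.assoc)
  qed
  have z3: "B x y * z * (u * v - v * u) = 0"
    if m: "x \<in> A" "y \<in> A" "z \<in> A" "u \<in> A" "v \<in> A" for x y z u v
  proof (rule semiprime)
    show "B x y * z * (u * v - v * u) \<in> A"
      using m by (intro mult_closed comm Bcl)
    fix w assume w: "w \<in> A"
    have "B x (y + v) * z * (u * (y + v) - (y + v) * u) = 0"
      using m by (intro z2 cl)
    then have "B x y * z * (u * y - y * u) + B x y * z * (u * v - v * u)
       + B x v * z * (u * y - y * u) + B x v * z * (u * v - v * u) = 0"
      using m by (simp add: Badd2 algebra_simps)
    then have e: "B x y * z * (u * v - v * u) = - (B x v * z * (u * y - y * u))"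
      using m by (simp add: z2 eq_neg_iff_add_eq_0)
    have "(u * v - v * u) * w * B x v = 0"
      by (rule flip_zero) (use m w Bcl comm z2 in auto)
    then have "B x y * z * ((u * v - v * u) * w * B x v) * z * (u * y - y * u) = 0"
      by simp
    then show "B x y * z * (u * v - v * u) * w * (B x y * z * (u * v - v * u)) = 0"
      by (subst (2) e) (simp add: mult.assoc)
  qed
  obtain e where e: "e \<in> A" "\<And>x. x * e = x" "\<And>x. e * x = x"
    using has_unit by blast
  define a where "a = B x y"
  define b where "b = x * y - y * x"
  have aA: "a \<in> A" and bA: "b \<in> A"
    using x y Bcl comm by (auto simp: a_def b_def)
  have az: "a * z * (u * v - v * u) = 0" if "z \<in> A" "u \<in> A" "v \<in> A" for z u v
    unfolding a_def using that x y by (intro z3)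
  have az1: "a * (u * v - v * u) = 0" if "u \<in> A" "v \<in> A" for u v
    using az[OF e(1) that] by (simp add: e)
  \<comment> \<open>Semiprimeness is applied to the commutator of \<open>a\<close> and
    \<open>w\<close> itself: after expansion each term ends in \<open>a\<close>, some element, and
    that commutator, so \<open>az\<close> kills it.\<close>
  have central: "a * w = w * a" if w: "w \<in> A" for w
  proof -
    have "a * w - w * a = 0"
    proof (rule semiprime)
      show "a * w - w * a \<in> A"
        using aA w by (rule comm)
      fix z assume z: "z \<in> A"
      have "(a * w - w * a) * z * (a * w - w * a)
          = a * (w * z) * (a * w - w * a) - w * (a * z * (a * w - w * a))"
        by (simp add: algebra_simps)
      then show "(a * w - w * a) * z * (a * w - w * a) = 0"
        using az aA w z by (simp add: mult_closed)
    qed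
    then show ?thesis
      by simp
  qed
  have ab: "a * b = 0"
    unfolding b_def using x y by (rule az1)
  have ba: "b * a = 0"
    using ab central[OF bA] by simp
  have 0: "\<delta> 0 = 0"
    using add[of "e - e" "e - e"] e(1) diff_closed[of e e] by simp
  \<comment> \<open>The Jordan identity for \<open>a * b + b * a = 0\<close>. Multiplied by
    \<open>a\<close> from the left it reduces to
    \<open>a * a * \<delta> b + a * \<delta> b * a = 0\<close>, and \<open>adb\<close> turns this
    into four times the cube of \<open>a\<close>.\<close>
  have "\<delta> a * b + a * \<delta> b + \<delta> b * a + b * \<delta> a = 0"
    using jp[OF aA bA] by (simp add: ab ba 0)
  then have "a * \<delta> a * b + a * a * \<delta> b + a * \<delta> b * a + a * b * \<delta> a = 0"
    by (metis (no_types, opaque_lifting) distrib_left mult.assoc mult_zero_right)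
  moreover have "a * \<delta> a * b = 0"
    unfolding b_def using az[OF map[OF aA] x y] .
  \<comment> \<open>Up to the commutators of \<open>\<delta> x\<close> with \<open>y\<close> and of
    \<open>x\<close> with \<open>\<delta> y\<close>, both annihilated by \<open>a\<close>, the
    element \<open>\<delta> b\<close> is \<open>2 a\<close>.\<close>
  moreover have adb: "a * \<delta> b = a * a + a * a"
  proof -
    have "\<delta> (x * y) = \<delta> b + \<delta> (y * x)"
      using add[of b "y * x"] bA x y by (simp add: b_def mult_closed)
    then have "\<delta> b = B x y - B y x + (\<delta> x * y - y * \<delta> x) + (x * \<delta> y - \<delta> y * x)"
      by (simp add: B_def algebra_simps)
    then have "\<delta> b = a + a + (\<delta> x * y - y * \<delta> x) + (x * \<delta> y - \<delta> y * x)"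
      using Banti[OF x y] by (simp add: a_def)
    then show ?thesis
      using az1[of "\<delta> x" y] az1[of x "\<delta> y"] x y map by (simp add: distrib_left)
  qed
  ultimately have "(a * a * a + a * a * a) + (a * a * a + a * a * a) = 0"
    using ab by (simp add: mult.assoc distrib_left distrib_right)
  then have a3: "a * a * a = 0"
    using double_zero by blast
  have a2: "a * a = 0"
  proof (rule semiprime)
    show "a * a \<in> A"
      using aA by (intro mult_closed)
    fix z assume z: "z \<in> A"
    have "a * a * z * (a * a) = a * (a * z) * (a * a)"
      by (simp add: mult.assoc)
    also have "\<dots> = a * (z * a) * (a * a)"
      by (simp only: central[OF z])
    also have "\<dots> = a * z * (a * a * a)"
      by (simp add: mult.assoc)
    also have "\<dots> = 0"
      by (simp add: a3)
    finally show "a * a * z * (a * a) = 0" .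
  qed
  have "a = 0"
  proof (rule semiprime[OF aA])
    fix z assume z: "z \<in> A"
    have "a * z * a = a * (a * z)"
      by (metis central[OF z] mult.assoc)
    then show "a * z * a = 0"
      using a2 by (simp flip: mult.assoc)
  qed
  then show ?thesis
    unfolding a_def B_def by (simp add: algebra_simps)
qed

end


section \<open>Dissipative maps\<close>

text \<open>Dissipativity makes \<open>x \<mapsto> norm (E x)\<close> lower semicontinuous on
  \<open>V\<close>: in \<open>est\<close> let \<open>z\<close> tend to \<open>x\<close> first and
  \<open>t\<close> to 0 afterwards. The sublevel sets \<open>F n\<close> are therefore closed, they
  cover \<open>V\<close>, and by Baire's theorem one of them has interior.\<close>

lemma dissipative_imp_bounded:
  fixes V :: "'v::banach set" and E :: "'v \<Rightarrow> 'v"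
  assumes cl: "closed V" and sub: "subspace V"
    and map: "\<And>x. x \<in> V \<Longrightarrow> E x \<in> V"
    and add: "\<And>x y. x \<in> V \<Longrightarrow> y \<in> V \<Longrightarrow> E (x + y) = E x + E y"
    and scale: "\<And>r x. x \<in> V \<Longrightarrow> E (r *\<^sub>R x) = r *\<^sub>R E x"
    and diss: "\<And>t x. x \<in> V \<Longrightarrow> norm x \<le> norm (x + t *\<^sub>R E x)"
  shows "\<exists>C\<ge>0. \<forall>x\<in>V. norm (E x) \<le> C * norm x"
proof -
  note sc = subspace_add[OF sub] subspace_diff[OF sub] subspace_scale[OF sub] subspace_0[OF sub]
  have Ediff: "E (x - y) = E x - E y" if "x \<in> V" "y \<in> V" for x y
    using add[of "x - y" y] that sc by simp
  have est: "norm (E x) \<le> 2 * norm (x - z) / t + norm (E z) + t * norm (E (E x))"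
    if "x \<in> V" "z \<in> V" "t > 0" for x z t
  proof -
    \<comment> \<open>Chosen so that \<open>E x\<close> cancels in
      \<open>a + t *\<^sub>R E a\<close>. The dissipative inequality for \<open>a\<close> then
      bounds \<open>norm (E x)\<close> by \<open>norm (E z)\<close> and two terms that become
      small.\<close>
    define a where "a = - E x + (1 / t) *\<^sub>R (x - z)"
    have aV: "a \<in> V"
      unfolding a_def using that sc map by (metis add.commute diff_conv_add_uminus)
    have Ea: "E a = (1 / t) *\<^sub>R (E x - E z) - E (E x)"
      using add[of "(1 / t) *\<^sub>R (x - z)" "(-1) *\<^sub>R E x"] that sc map
      by (simp add: a_def scale Ediff add.commute)
    have "norm (E x) \<le> norm a + norm (x - z) / t"
    proof -
      have "E x = (1 / t) *\<^sub>R (x - z) - a"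
        by (simp add: a_def)
      then have "norm (E x) \<le> norm ((1 / t) *\<^sub>R (x - z)) + norm a"
        by (metis norm_triangle_ineq4)
      then show ?thesis
        using that by simp
    qed
    also have "norm a \<le> norm (a + t *\<^sub>R E a)"
      using aV by (rule diss)
    also have "a + t *\<^sub>R E a = (1 / t) *\<^sub>R (x - z) - E z - t *\<^sub>R E (E x)"
      using that unfolding Ea by (simp add: a_def algebra_simps)
    also have "norm \<dots> \<le> norm (x - z) / t + norm (E z) + t * norm (E (E x))"
      using norm_triangle_ineq4[of "(1 / t) *\<^sub>R (x - z) - E z" "t *\<^sub>R E (E x)"]
        norm_triangle_ineq4[of "(1 / t) *\<^sub>R (x - z)" "E z"] that by simp
    finally show ?thesis
      by (simp add: field_simps)
  qed
  define F where "F n = {x \<in> V. norm (E x) \<le> real n}" for n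
  have "closed (F n)" for n
    unfolding closed_sequential_limits
  proof safe
    fix s l assume s: "\<forall>k. s k \<in> F n" and lim: "s \<longlonglongrightarrow> l"
    have lV: "l \<in> V"
      using closed_sequentially[OF cl _ lim] s by (auto simp: F_def)
    have 1: "norm (E l) \<le> real n + t * norm (E (E l))" if t: "t > 0" for t
    proof (rule tendsto_lowerbound)
      show "(\<lambda>k. 2 * norm (l - s k) / t + real n + t * norm (E (E l)))
          \<longlonglongrightarrow> real n + t * norm (E (E l))"
        using t by (auto intro!: tendsto_eq_intros lim)
      show "\<forall>\<^sub>F k in sequentially. norm (E l) \<le> 2 * norm (l - s k) / t + real n + t * norm (E (E l))"
        using est[OF lV _ t] s by (auto simp: F_def intro!: always_eventually) (smt (verit))
    qed simp
    have "norm (E l) \<le> real n"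
    proof (rule tendsto_lowerbound)
      show "((\<lambda>t. real n + t * norm (E (E l))) \<longlongrightarrow> real n) (at_right 0)"
        by (auto intro!: tendsto_eq_intros)
      show "\<forall>\<^sub>F t in at_right 0. norm (E l) \<le> real n + t * norm (E (E l))"
        using 1 by (auto simp: eventually_at_right_less intro: eventually_mono[OF eventually_at_right_less])
    qed simp
    then show "l \<in> F n"
      using lV by (simp add: F_def)
  qed
  then have clF: "closedin (top_of_set V) (F n)" for n
    by (simp add: F_def closed_subset subset_iff)
  have "\<exists>n. (top_of_set V) interior_of F n \<noteq> {}"
  proof (rule ccontr)
    assume none: "\<not> (\<exists>n. (top_of_set V) interior_of F n \<noteq> {})"
    have "(top_of_set V) interior_of \<Union> (range F) = {}"
    proof (intro Baire_category_alt disjI1)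
      show "completely_metrizable_space (top_of_set V)"
        using cl by (metis closed_closedin completely_metrizable_space_closedin
            completely_metrizable_space_euclidean)
    qed (use clF none in auto)
    moreover have "\<Union> (range F) = V"
      by (auto simp: F_def real_arch_simple)
    ultimately show False
      using sc(4) by (metis empty_iff interior_of_topspace topspace_euclidean_subtopology)
  qed
  then obtain n x0 where "x0 \<in> (top_of_set V) interior_of F n"
    by blast
  then obtain U where U: "open U" "x0 \<in> U" "V \<inter> U \<subseteq> F n" "x0 \<in> V"
    unfolding interior_of_def by (auto simp: openin_open)
  then obtain r where r: "r > 0" "ball x0 r \<subseteq> U"
    by (meson open_contains_ball)
  have x0: "norm (E x0) \<le> n"
    using U by (auto simp: F_def)
  have "norm (E x) \<le> (4 * real n / r) * norm x" if x: "x \<in> V" for x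
  proof (cases "x = 0")
    case True
    then show ?thesis
      using scale[of 0 0] sc(4) by simp
  next
    case False
    define c where "c = r / (2 * norm x)"
    have c: "c > 0"
      using r False by (simp add: c_def)
    have "x0 + c *\<^sub>R x \<in> ball x0 r"
      using r(1) False by (simp add: dist_norm c_def)
    moreover have "x0 + c *\<^sub>R x \<in> V"
      using U(4) x by (intro sc)
    ultimately have "x0 + c *\<^sub>R x \<in> F n"
      using U(3) r(2) by blast
    then have "norm (E x0 + c *\<^sub>R E x) \<le> n"
      using U x sc by (simp add: F_def add scale)
    then have "norm (c *\<^sub>R E x) \<le> 2 * real n"
      using x0 norm_triangle_ineq4[of "E x0 + c *\<^sub>R E x" "E x0"] by simp
    then have "c * norm (E x) \<le> 2 * real n"
      using c by simp
    then show ?thesis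
      using r(1) False c by (simp add: c_def field_simps)
  qed
  moreover have "0 \<le> 4 * real n / r"
    using r by simp
  ultimately show ?thesis
    by blast
qed


section \<open>The inner product\<close>

lemma cinner_add_right: "cinner x (y + z) = cinner x y + cinner x (z::'a::complex_inner)"
  by (metis cinner_add_left cinner_commute complex_cnj_add)

lemma cinner_scaleC_right: "cinner x (c *\<^sub>C y) = cnj c * cinner x (y::'a::complex_inner)"
  by (metis cinner_commute cinner_scaleC_left complex_cnj_mult)

lemma cinner_scaleR_left: "cinner (r *\<^sub>R x) y = of_real r * cinner x (y::'a::complex_inner)"
  by (metis cinner_scaleC_left scaleC_of_real)

lemma cinner_scaleR_right: "cinner x (r *\<^sub>R y) = of_real r * cinner x (y::'a::complex_inner)"
  by (metis cinner_scaleC_right scaleC_of_real complex_cnj_complex_of_real)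

lemma cinner_zero [simp]: "cinner 0 y = 0" "cinner y 0 = (0::complex)" for y :: "'a::complex_inner"
  using cinner_scaleR_left[of 0 y y] cinner_scaleR_right[of y 0 y] by simp_all

lemma cinner_minus_left: "cinner (- x) y = - cinner x (y::'a::complex_inner)"
  using cinner_scaleR_left[of "-1" x y] by simp

lemma cinner_minus_right: "cinner x (- y) = - cinner x (y::'a::complex_inner)"
  using cinner_scaleR_right[of x "-1" y] by simp

lemma cinner_diff_left: "cinner (x - z) y = cinner x y - cinner z (y::'a::complex_inner)"
  using cinner_add_left[of x "- z" y] by (simp add: cinner_minus_left)

lemma cinner_diff_right: "cinner x (y - z) = cinner x y - cinner x (z::'a::complex_inner)"
  using cinner_add_right[of x y "- z"] by (simp add: cinner_minus_right)

lemmas cinner_simps = cinner_add_left cinner_add_right cinner_diff_left cinner_diff_right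
  cinner_minus_left cinner_minus_right cinner_scaleR_left cinner_scaleR_right
  cinner_scaleC_left cinner_scaleC_right

lemma cinner_self: "cinner x x = of_real ((norm (x::'a::complex_inner))\<^sup>2)"
proof -
  have "Im (cinner x x) = 0"
    using cinner_commute[of x x] by (metis complex_cnj_cancel_iff complex_is_Real_iff Reals_cnj_iff)
  then show ?thesis
    by (simp add: norm_eq_sqrt_cinner[of x] cinner_ge_zero complex_eq_iff)
qed

lemma Re_cinner_commute: "Re (cinner y x) = Re (cinner x (y::'a::complex_inner))"
  by (metis cinner_commute complex_cnj(1) complex.sel(1) complex_surj)

lemma norm_add_sq: "(norm (x + y))\<^sup>2 = (norm x)\<^sup>2 + 2 * Re (cinner x y) + (norm (y::'a::complex_inner))\<^sup>2"
proof -
  have "of_real ((norm (x + y))\<^sup>2) = cinner (x + y) (x + y)"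
    by (simp only: cinner_self)
  then have "(norm (x + y))\<^sup>2 = Re (cinner (x + y) (x + y))"
    by (metis Re_complex_of_real)
  also have "\<dots> = Re (cinner x x + cinner x y + (cinner y x + cinner y y))"
    by (simp only: cinner_add_left cinner_add_right add_ac)
  finally show ?thesis
    by (simp add: cinner_self Re_cinner_commute[of y x])
qed

lemma norm_diff_sq: "(norm (x - y))\<^sup>2 = (norm x)\<^sup>2 - 2 * Re (cinner x y) + (norm (y::'a::complex_inner))\<^sup>2"
  using norm_add_sq[of x "- y"] by (simp add: cinner_simps)

lemma Re_cinner_le: "Re (cinner x y) \<le> norm x * norm (y::'a::complex_inner)"
proof -
  have "(norm (x + y))\<^sup>2 \<le> (norm x + norm y)\<^sup>2"
    by (intro power_mono norm_triangle_ineq) simp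
  then show ?thesis
    by (simp add: norm_add_sq power2_sum)
qed

lemma norm_cinner_le: "cmod (cinner x y) \<le> norm x * norm (y::'a::complex_inner)"
proof (cases "cinner x y = 0")
  case False
  define c where "c = cnj (cinner x y) / of_real (cmod (cinner x y))"
  have "cmod c = 1"
    using False by (simp add: c_def norm_divide)
  have "c * cinner x y = of_real (cmod (cinner x y))"
    using False by (simp add: c_def complex_norm_square[symmetric] power2_eq_square mult.commute
        divide_simps flip: of_real_mult)
  then have "cmod (cinner x y) = Re (cinner (c *\<^sub>C x) y)"
    by (simp add: cinner_simps)
  also have "\<dots> \<le> norm x * norm y"
    using Re_cinner_le[of "c *\<^sub>C x" y] \<open>cmod c = 1\<close> by (simp add: norm_scaleC)
  finally show ?thesis .
qed simp

lemma cinner_eqI: "(\<And>y. cinner x y = cinner z y) \<Longrightarrow> x = (z::'a::complex_inner)"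
  using cinner_self[of "x - z"] by (simp add: cinner_diff_left)

lemma tendsto_cinner [tendsto_intros]:
  fixes f g :: "'b \<Rightarrow> 'a::complex_inner"
  assumes "(f \<longlongrightarrow> a) F" "(g \<longlongrightarrow> b) F"
  shows "((\<lambda>x. cinner (f x) (g x)) \<longlongrightarrow> cinner a b) F"
proof -
  have "bounded_bilinear (\<lambda>x y::'a. cinner x y)"
  proof
    show "\<exists>K. \<forall>a b::'a. cmod (cinner a b) \<le> norm a * norm b * K"
      by (intro exI[of _ 1]) (simp add: norm_cinner_le)
  qed (simp_all add: cinner_simps scaleR_conv_of_real)
  then show ?thesis
    using assms by (rule bounded_bilinear.tendsto)
qed


section \<open>The algebra of adjointable operators\<close>

lemma scaleC_zero_right [simp]: "c *\<^sub>C 0 = (0::'a::complex_inner)"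
  using scaleC_add_right[of c 0 "0::'a"] by simp

text \<open>Only operators that possess an adjoint are considered, so the Riesz representation
  theorem is not needed.\<close>

typedef (overloaded) 'a cop =
  "{T :: 'a::chilbert_space \<Rightarrow>\<^sub>L 'a. T \<in> bounded_ops \<and> (\<exists>S\<in>bounded_ops. is_adjoint T S)}"
  morphisms blf Cop
  by (rule exI[of _ 0]) (auto simp: bounded_ops_def is_adjoint_def intro!: exI[of _ 0])

setup_lifting type_definition_cop

definition ap :: "'a::chilbert_space cop \<Rightarrow> 'a \<Rightarrow> 'a" (infixr "\<cdot>" 75)
  where "T \<cdot> x = blinfun_apply (blf T) x"

lemma scaleC_one [simp]: "1 *\<^sub>C x = (x::'a::complex_inner)"
  using scaleC_of_real[of 1 x] by simp

lemma scaleC_minus_right: "c *\<^sub>C (- x) = - (c *\<^sub>C (x::'a::complex_inner))"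
  using scaleC_add_right[of c x "- x"] by (simp add: eq_neg_iff_add_eq_0 add.commute)

lemma scaleC_diff_right: "c *\<^sub>C (x - y) = c *\<^sub>C x - c *\<^sub>C (y::'a::complex_inner)"
  using scaleC_add_right[of c x "- y"] by (simp add: scaleC_minus_right)

lemma scaleC_scaleR: "c *\<^sub>C (r *\<^sub>R x) = r *\<^sub>R (c *\<^sub>C (x::'a::complex_inner))"
  by (metis mult.commute scaleC_of_real scaleC_scaleC)

lemma bounded_ops_add: "S \<in> bounded_ops \<Longrightarrow> T \<in> bounded_ops \<Longrightarrow> S + T \<in> bounded_ops"
  by (simp add: bounded_ops_def blinfun.add_left scaleC_add_right)

lemma bounded_ops_minus: "S \<in> bounded_ops \<Longrightarrow> - S \<in> bounded_ops"
  by (simp add: bounded_ops_def blinfun.minus_left scaleC_minus_right)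

lemma bounded_ops_diff: "S \<in> bounded_ops \<Longrightarrow> T \<in> bounded_ops \<Longrightarrow> S - T \<in> bounded_ops"
  by (simp add: bounded_ops_def blinfun.diff_left scaleC_diff_right)

lemma bounded_ops_scaleR: "S \<in> bounded_ops \<Longrightarrow> r *\<^sub>R S \<in> bounded_ops"
  by (simp add: bounded_ops_def blinfun.scaleR_left scaleC_scaleR)

lemma bounded_ops_scaleC: "S \<in> bounded_ops \<Longrightarrow> scaleC_op c S \<in> bounded_ops"
  by (simp add: bounded_ops_def scaleC_op.rep_eq scaleC_scaleC mult.commute)

lemma bounded_ops_compose: "S \<in> bounded_ops \<Longrightarrow> T \<in> bounded_ops \<Longrightarrow> S o\<^sub>L T \<in> bounded_ops"
  by (simp add: bounded_ops_def)

lemma bounded_ops_id: "id_blinfun \<in> bounded_ops"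
  by (simp add: bounded_ops_def)

lemma bounded_ops_0: "0 \<in> bounded_ops"
  by (simp add: bounded_ops_def)

lemma is_adjoint_add: "is_adjoint T S \<Longrightarrow> is_adjoint T' S' \<Longrightarrow> is_adjoint (T + T') (S + S')"
  by (simp add: is_adjoint_def blinfun.add_left cinner_simps)

lemma is_adjoint_diff: "is_adjoint T S \<Longrightarrow> is_adjoint T' S' \<Longrightarrow> is_adjoint (T - T') (S - S')"
  by (simp add: is_adjoint_def blinfun.diff_left cinner_simps)

lemma is_adjoint_minus: "is_adjoint T S \<Longrightarrow> is_adjoint (- T) (- S)"
  by (simp add: is_adjoint_def blinfun.minus_left cinner_simps)

lemma is_adjoint_scaleR: "is_adjoint T S \<Longrightarrow> is_adjoint (r *\<^sub>R T) (r *\<^sub>R S)"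
  by (simp add: is_adjoint_def blinfun.scaleR_left cinner_simps)

lemma is_adjoint_scaleC: "is_adjoint T S \<Longrightarrow> is_adjoint (scaleC_op c T) (scaleC_op (cnj c) S)"
  by (simp add: is_adjoint_def scaleC_op.rep_eq cinner_simps)

lemma is_adjoint_compose: "is_adjoint T S \<Longrightarrow> is_adjoint T' S' \<Longrightarrow> is_adjoint (T o\<^sub>L T') (S' o\<^sub>L S)"
  by (simp add: is_adjoint_def)

lemma is_adjoint_id: "is_adjoint id_blinfun id_blinfun"
  by (simp add: is_adjoint_def)

lemma is_adjoint_0: "is_adjoint 0 0"
  by (simp add: is_adjoint_def)

lemma is_adjoint_sym:
  assumes "is_adjoint T S" shows "is_adjoint S T"
  unfolding is_adjoint_def
proof safe
  fix x y
  have "cinner (S x) y = cnj (cinner (T y) x)"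
    using assms cinner_commute[of "S x" y] by (simp add: is_adjoint_def)
  then show "cinner (S x) y = cinner x (T y)"
    using cinner_commute[of x "T y"] by simp
qed

lemma is_adjoint_unique:
  assumes "is_adjoint T S" "is_adjoint T S'" shows "S = S'"
proof (rule blinfun_eqI, rule cinner_eqI)
  show "cinner (S x) y = cinner (S' x) y" for x y
    using assms[THEN is_adjoint_sym] by (simp add: is_adjoint_def)
qed

lemma is_adjoint_norm_le:
  assumes "is_adjoint T S" shows "norm S \<le> norm T"
proof (rule norm_blinfun_bound)
  fix x
  have "(norm (S x))\<^sup>2 = Re (cinner (T (S x)) x)"
    using assms unfolding is_adjoint_def by (simp add: cinner_self)
  also have "\<dots> \<le> norm T * norm (S x) * norm x"
    by (meson Re_cinner_le mult_right_mono norm_blinfun norm_ge_zero order_trans)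
  finally show "norm (S x) \<le> norm T * norm x"
    by (cases "S x = 0") (auto simp: power2_eq_square ac_simps)
qed simp

text \<open>The class \<open>real_normed_algebra_1\<close> requires \<open>norm 1 = 1\<close>, which
  is false over the zero space. The unit and the powers therefore come from
  \<open>monoid_mult\<close>, and the estimates use only \<open>norm 1 \<le> 1\<close>.\<close>

instantiation cop :: (chilbert_space) "{real_normed_algebra, monoid_mult}"
begin

lift_definition zero_cop :: "'a cop" is 0
  using bounded_ops_0 is_adjoint_0 by blast
lift_definition one_cop :: "'a cop" is id_blinfun
  using bounded_ops_id is_adjoint_id by blast
lift_definition plus_cop :: "'a cop \<Rightarrow> 'a cop \<Rightarrow> 'a cop" is "(+)"
  using bounded_ops_add is_adjoint_add by blast
lift_definition minus_cop :: "'a cop \<Rightarrow> 'a cop \<Rightarrow> 'a cop" is "(-)"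
  using bounded_ops_diff is_adjoint_diff by blast
lift_definition uminus_cop :: "'a cop \<Rightarrow> 'a cop" is uminus
  using bounded_ops_minus is_adjoint_minus by blast
lift_definition times_cop :: "'a cop \<Rightarrow> 'a cop \<Rightarrow> 'a cop" is "(o\<^sub>L)"
  using bounded_ops_compose is_adjoint_compose by blast
lift_definition scaleR_cop :: "real \<Rightarrow> 'a cop \<Rightarrow> 'a cop" is "(*\<^sub>R)"
  using bounded_ops_scaleR is_adjoint_scaleR by blast
lift_definition norm_cop :: "'a cop \<Rightarrow> real" is norm .
definition sgn_cop :: "'a cop \<Rightarrow> 'a cop" where "sgn_cop x = inverse (norm x) *\<^sub>R x"
definition dist_cop :: "'a cop \<Rightarrow> 'a cop \<Rightarrow> real" where "dist_cop x y = norm (x - y)"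
definition uniformity_cop :: "('a cop \<times> 'a cop) filter"
  where "uniformity_cop = (INF e\<in>{0 <..}. principal {(x, y). dist x y < e})"
definition open_cop :: "'a cop set \<Rightarrow> bool"
  where "open_cop U = (\<forall>x\<in>U. \<forall>\<^sub>F (x', y) in uniformity. x' = x \<longrightarrow> y \<in> U)"

instance
proof
  fix a b c x y :: "'a cop" and r s :: real and U :: "'a cop set"
  show "dist x y = norm (x - y)" "sgn x = inverse (norm x) *\<^sub>R x"
    "(uniformity :: ('a cop \<times> 'a cop) filter) = (INF e\<in>{0 <..}. principal {(x, y). dist x y < e})"
    "open U = (\<forall>x\<in>U. \<forall>\<^sub>F (x', y) in uniformity. x' = x \<longrightarrow> y \<in> U)"
    by (simp_all only: dist_cop_def sgn_cop_def uniformity_cop_def open_cop_def)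
  show "norm (x * y) \<le> norm x * norm y"
    by transfer (rule norm_blinfun_compose)
  show "norm (x + y) \<le> norm x + norm y"
    by transfer (rule norm_triangle_ineq)
  show "a * b * c = a * (b * c)" "(a + b) * c = a * c + b * c" "a * (b + c) = a * b + a * c"
    "r *\<^sub>R x * y = r *\<^sub>R (x * y)" "x * r *\<^sub>R y = r *\<^sub>R (x * y)" "1 * a = a" "a * 1 = a"
    by (transfer; auto intro!: blinfun_eqI simp: blinfun.bilinear_simps)+
  show "a + b + c = a + (b + c)" "a + b = b + a" "0 + a = a" "- a + a = 0" "a - b = a + - b"
    "r *\<^sub>R (x + y) = r *\<^sub>R x + r *\<^sub>R y" "(r + s) *\<^sub>R x = r *\<^sub>R x + s *\<^sub>R x"
    "r *\<^sub>R s *\<^sub>R x = (r * s) *\<^sub>R x" "1 *\<^sub>R x = x" "norm x = 0 \<longleftrightarrow> x = 0"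
    "norm (r *\<^sub>R x) = \<bar>r\<bar> * norm x"
    by (transfer; simp add: algebra_simps)+
qed

end

text \<open>Scalar operators. As an instance \<open>cop\<close> is an algebra over the reals; a
  complex multiple of \<open>T\<close> is written as the product \<open>cc c * T\<close>, so that
  the ring laws apply to it.\<close>

lift_definition cc :: "complex \<Rightarrow> 'a::chilbert_space cop" is "\<lambda>c. scaleC_op c id_blinfun"
  using bounded_ops_scaleC bounded_ops_id is_adjoint_scaleC is_adjoint_id by blast

lift_definition star :: "'a::chilbert_space cop \<Rightarrow> 'a cop" is "\<lambda>T. THE S. is_adjoint T S"
  by (metis (mono_tags, lifting) is_adjoint_sym is_adjoint_unique the_equality mem_Collect_eq)

lemma blf_linear: "blinfun_apply (blf T) (c *\<^sub>C x) = c *\<^sub>C blinfun_apply (blf T) x"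
  using blf[of T] by (auto simp: bounded_ops_def)

lemma ap_simps [simp]:
  "(0::'a::chilbert_space cop) \<cdot> x = 0" "(1::'a cop) \<cdot> x = x" "(S + T) \<cdot> x = S \<cdot> x + T \<cdot> x"
  "(S - T) \<cdot> x = S \<cdot> x - T \<cdot> x" "(- T) \<cdot> x = - (T \<cdot> x)" "(S * T) \<cdot> x = S \<cdot> T \<cdot> x"
  "(r *\<^sub>R T) \<cdot> x = r *\<^sub>R (T \<cdot> x)" "cc c \<cdot> x = c *\<^sub>C x"
  "T \<cdot> 0 = 0" "T \<cdot> (x + y) = T \<cdot> x + T \<cdot> y" "T \<cdot> (x - y) = T \<cdot> x - T \<cdot> y" "T \<cdot> (- x) = - (T \<cdot> x)"
  "T \<cdot> (r *\<^sub>R x) = r *\<^sub>R (T \<cdot> x)" "T \<cdot> (c *\<^sub>C x) = c *\<^sub>C (T \<cdot> x)"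
  by (simp_all add: ap_def blinfun.bilinear_simps zero_cop.rep_eq one_cop.rep_eq plus_cop.rep_eq
      minus_cop.rep_eq uminus_cop.rep_eq times_cop.rep_eq scaleR_cop.rep_eq cc.rep_eq
      scaleC_op.rep_eq blf_linear)

lemma cop_eqI: "(\<And>x. S \<cdot> x = T \<cdot> x) \<Longrightarrow> S = T"
  by (metis ap_def blinfun_eqI blf_inject)

lemma is_adjoint_star: "is_adjoint (blf T) (blf (star T))"
proof -
  obtain S where "is_adjoint (blf T) S"
    using blf[of T] by auto
  then show ?thesis
    unfolding star.rep_eq by (metis (mono_tags) is_adjoint_unique theI)
qed

lemma star_unique: "is_adjoint (blf T) (blf S) \<Longrightarrow> star T = S"
  by (metis is_adjoint_star is_adjoint_unique blf_inject)

lemma cinner_star: "cinner (T \<cdot> x) y = cinner x (star T \<cdot> y)"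
  using is_adjoint_star[of T] by (simp add: is_adjoint_def ap_def)

lemma cinner_star': "cinner x (T \<cdot> y) = cinner (star T \<cdot> x) y"
  using is_adjoint_sym[OF is_adjoint_star[of T]] by (simp add: is_adjoint_def ap_def)

lemma starI: "(\<And>x y. cinner (T \<cdot> x) y = cinner x (S \<cdot> y)) \<Longrightarrow> star T = S"
  by (intro star_unique) (simp add: is_adjoint_def ap_def)

lemma star_star [simp]: "star (star T) = T"
  by (rule starI) (simp add: cinner_star')

lemma star_simps [simp]:
  "star 0 = 0" "star 1 = 1" "star (S + T) = star S + star T" "star (S - T) = star S - star T"
  "star (- T) = - star T" "star (S * T) = star T * star S" "star (r *\<^sub>R T) = r *\<^sub>R star T"
  "star (cc c) = cc (cnj c)"
  by (auto intro!: starI simp: cinner_simps cinner_star)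

lemma star_power: "star (T ^ n) = star T ^ n"
  by (induction n) (simp_all add: power_commutes)

lemma star_eq_0 [simp]: "star T = 0 \<longleftrightarrow> T = 0"
  by (metis star_simps(1) star_star)

lemma cc_simps: "cc (a + b) = cc a + cc b" "cc (a * b) = cc a * cc b" "cc 0 = 0" "cc 1 = 1"
    "cc (of_real r) = r *\<^sub>R 1"
  by (rule cop_eqI; simp add: scaleC_add_left scaleC_scaleC scaleC_of_real
      scaleC_of_real[of 0, simplified] mult.commute)+

lemma cc_minus: "cc (- a) = - cc a"
  using cc_simps(1)[of a "- a"] by (simp add: cc_simps eq_neg_iff_add_eq_0 add.commute)

lemma cc_commute: "T * cc c = cc c * T"
  by (rule cop_eqI) simp

lemma norm_ap_le: "norm (T \<cdot> x) \<le> norm T * norm x"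
  by (simp add: ap_def norm_cop.rep_eq norm_blinfun)

lemma norm_cop_bound: "0 \<le> c \<Longrightarrow> (\<And>x. norm (T \<cdot> x) \<le> c * norm x) \<Longrightarrow> norm T \<le> c"
  unfolding ap_def norm_cop.rep_eq by (rule norm_blinfun_bound)

lemma norm_star [simp]: "norm (star T) = norm T"
  using is_adjoint_norm_le[OF is_adjoint_star[of T]] is_adjoint_norm_le[OF is_adjoint_star[of "star T"]]
  by (simp add: norm_cop.rep_eq)

lemma norm_one_cop_le: "norm (1::'a::chilbert_space cop) \<le> 1"
  by (rule norm_cop_bound) simp_all

lemma norm_cc_le: "norm (cc c :: 'a::chilbert_space cop) \<le> cmod c"
  by (rule norm_cop_bound) (simp_all add: norm_scaleC)

lemma norm_ap_sq: "(norm (T \<cdot> x))\<^sup>2 = Re (cinner ((star T * T) \<cdot> x) x)"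
  by (simp add: cinner_star' [symmetric] cinner_self flip: cinner_star)

lemma star_mult_self_eq_0: "star T * T = 0 \<longleftrightarrow> T = 0"
proof
  assume "star T * T = 0"
  then have "norm (T \<cdot> x) = 0" for x
    using norm_ap_sq[of T x] by simp
  then show "T = 0"
    by (intro cop_eqI) simp
qed simp

lemma tendsto_star [tendsto_intros]: "(f \<longlongrightarrow> l) F \<Longrightarrow> ((\<lambda>x. star (f x)) \<longlongrightarrow> star l) F"
proof -
  have "bounded_linear star"
    by (rule bounded_linear_intro[where K = 1]) simp_all
  then show "(f \<longlongrightarrow> l) F \<Longrightarrow> ((\<lambda>x. star (f x)) \<longlongrightarrow> star l) F"
    by (rule bounded_linear.tendsto)
qed

lemma tendsto_ap [tendsto_intros]:
  assumes "(f \<longlongrightarrow> T) F" shows "((\<lambda>n. f n \<cdot> x) \<longlongrightarrow> T \<cdot> x) F"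
proof -
  have "bounded_linear (\<lambda>T. T \<cdot> x)"
    by (rule bounded_linear_intro[where K = "norm x"]) (simp_all add: norm_ap_le)
  then show ?thesis
    using assms by (rule bounded_linear.tendsto)
qed

subclass (in chilbert_space) banach ..

text \<open>Adjointability survives norm limits because \<open>star\<close> is isometric: the
  adjoints also form a Cauchy sequence, and their limit is an adjoint of the limit.\<close>

instance cop :: (chilbert_space) banach
proof
  fix X :: "nat \<Rightarrow> 'a cop" assume X: "Cauchy X"
  have n: "norm (blf S - blf T) = norm (S - T)" for S T :: "'a cop"
    by (simp add: norm_cop.rep_eq minus_cop.rep_eq)
  have C: "Cauchy (\<lambda>n. blf (X n))" "Cauchy (\<lambda>n. blf (star (X n)))"
    using X by (simp_all add: Cauchy_def dist_norm n flip: star_simps)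
  then obtain L L' where L: "(\<lambda>n. blf (X n)) \<longlonglongrightarrow> L" and L': "(\<lambda>n. blf (star (X n))) \<longlonglongrightarrow> L'"
    by (meson Cauchy_convergent convergent_def)
  have bl: "K \<in> bounded_ops" if "(\<lambda>n. blf (Y n)) \<longlonglongrightarrow> K" for Y and K :: "'a \<Rightarrow>\<^sub>L 'a"
    unfolding bounded_ops_def
  proof safe
    fix c x
    have "(\<lambda>n. blf (Y n) (c *\<^sub>C x)) \<longlonglongrightarrow> K (c *\<^sub>C x)"
      using that by (intro tendsto_intros)
    moreover have "(\<lambda>n. c *\<^sub>C blf (Y n) x) \<longlonglongrightarrow> c *\<^sub>C K x"
      using that by (intro bounded_linear.tendsto[OF bounded_linear_scaleC] tendsto_intros)
    ultimately show "K (c *\<^sub>C x) = c *\<^sub>C K x"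
      by (simp add: blf_linear LIMSEQ_unique)
  qed
  have "is_adjoint L L'"
    unfolding is_adjoint_def
  proof safe
    fix x y
    have "(\<lambda>n. cinner (blf (X n) x) y) \<longlonglongrightarrow> cinner (L x) y"
      using L by (intro tendsto_intros)
    moreover have "(\<lambda>n. cinner x (blf (star (X n)) y)) \<longlonglongrightarrow> cinner x (L' y)"
      using L' by (intro tendsto_intros)
    moreover have "cinner (blf (X n) x) y = cinner x (blf (star (X n)) y)" for n
      using is_adjoint_star[of "X n"] by (simp add: is_adjoint_def)
    ultimately show "cinner (L x) y = cinner x (L' y)"
      by (simp add: LIMSEQ_unique)
  qed
  then have "blf (Cop L) = L"
    using bl[OF L] bl[OF L'] by (subst Cop_inverse) blast+
  then have "dist (X k) (Cop L) = dist (blf (X k)) L" for k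
    unfolding dist_norm by (metis n)
  then have "X \<longlonglongrightarrow> Cop L"
    using L by (simp add: tendsto_iff)
  then show "convergent X"
    by (auto simp: convergent_def)
qed


section \<open>Positive operators\<close>

abbreviation selfadj :: "'a::chilbert_space cop \<Rightarrow> bool"
  where "selfadj T \<equiv> star T = T"

definition pos :: "'a::chilbert_space cop \<Rightarrow> bool"
  where "pos T \<longleftrightarrow> (\<forall>x. cinner (T \<cdot> x) x \<in> \<real>\<^sub>\<ge>\<^sub>0)"

text \<open>Polarisation. The vector \<open>x + y\<close> makes the sesquilinear form antisymmetric
  in the sense of \<open>1\<close>; replacing \<open>x\<close> by \<open>\<i> *\<^sub>C x\<close>
  makes it symmetric as well.\<close>

lemma quadratic_form_zero:
  assumes "\<And>x. cinner (U \<cdot> x) x = 0" shows "U = 0"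
proof (rule cop_eqI, rule cinner_eqI)
  fix x y
  have 1: "cinner (U \<cdot> x) y + cinner (U \<cdot> y) x = 0" for x y
    using assms[of "x + y"] assms[of x] assms[of y] by (simp add: cinner_simps add.commute)
  have "\<i> * (cinner (U \<cdot> x) y - cinner (U \<cdot> y) x) = 0"
    using 1[of "\<i> *\<^sub>C x" y] by (simp add: cinner_simps algebra_simps)
  then show "cinner (U \<cdot> x) y = cinner (0 \<cdot> x) y"
    using 1[of x y] by simp
qed

lemma pos_imp_selfadj: assumes "pos T" shows "selfadj T"
proof -
  have "cinner ((T - star T) \<cdot> x) x = 0" for x
  proof -
    have "cinner (star T \<cdot> x) x = cnj (cinner (T \<cdot> x) x)"
      by (metis cinner_commute cinner_star')
    also have "\<dots> = cinner (T \<cdot> x) x"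
      using assms unfolding pos_def by (metis Reals_cnj_iff nonneg_Reals_subset_Reals subsetD)
    finally show ?thesis
      by (simp add: cinner_simps)
  qed
  then have "T - star T = 0"
    by (rule quadratic_form_zero)
  then show ?thesis
    by simp
qed

lemma posD: "pos T \<Longrightarrow> 0 \<le> Re (cinner (T \<cdot> x) x)"
  by (simp add: pos_def complex_nonneg_Reals_iff)

lemma posI: assumes "selfadj T" "\<And>x. 0 \<le> Re (cinner (T \<cdot> x) x)" shows "pos T"
proof -
  have "cnj (cinner (T \<cdot> x) x) = cinner (T \<cdot> x) x" for x
    by (metis cinner_commute cinner_star' assms(1))
  then have "Im (cinner (T \<cdot> x) x) = 0" for x
    by (metis Reals_cnj_iff complex_is_Real_iff)
  then show ?thesis
    using assms(2) by (simp add: pos_def complex_nonneg_Reals_iff)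
qed

lemma pos_add: "pos S \<Longrightarrow> pos T \<Longrightarrow> pos (S + T)"
  by (rule posI) (simp_all add: pos_imp_selfadj posD cinner_simps)

lemma pos_scaleR: "0 \<le> r \<Longrightarrow> pos T \<Longrightarrow> pos (r *\<^sub>R T)"
  by (rule posI) (simp_all add: pos_imp_selfadj posD cinner_simps)

lemma pos_zero: "pos 0"
  by (simp add: pos_def)

lemma pos_one: "pos 1"
  by (rule posI) (simp_all add: cinner_self)

lemma pos_conj: assumes "pos T" shows "pos (star V * T * V)"
proof (rule posI)
  show "selfadj (star V * T * V)"
    using pos_imp_selfadj[OF assms] by (simp add: mult.assoc)
  show "0 \<le> Re (cinner ((star V * T * V) \<cdot> x) x)" for x
    using posD[OF assms, of "V \<cdot> x"] by (simp flip: cinner_star')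
qed

lemma pos_star_mult: "pos (star V * V)"
  using pos_conj[OF pos_one, of V] by simp

text \<open>The norm of a self-adjoint operator is its numerical radius. Polarise at
  \<open>x\<close> and a multiple \<open>y\<close> of \<open>T \<cdot> x\<close> with the length of
  \<open>x\<close>; the parallelogram law adds up the two bounds.\<close>

lemma selfadj_norm_le:
  assumes "selfadj T" "0 \<le> c" and c: "\<And>x. \<bar>Re (cinner (T \<cdot> x) x)\<bar> \<le> c * (norm x)\<^sup>2"
  shows "norm T \<le> c"
proof (rule norm_cop_bound[OF \<open>0 \<le> c\<close>])
  fix x
  show "norm (T \<cdot> x) \<le> c * norm x"
  proof (cases "T \<cdot> x = 0")
    case False
    then have x: "x \<noteq> 0"
      by auto
    define y where "y = (norm x / norm (T \<cdot> x)) *\<^sub>R (T \<cdot> x)"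
    have ny: "norm y = norm x"
      using False by (simp add: y_def)
    have sym: "cinner (T \<cdot> y) x = cnj (cinner (T \<cdot> x) y)"
      by (metis assms(1) cinner_commute cinner_star)
    have "4 * Re (cinner (T \<cdot> x) y)
        = Re (cinner (T \<cdot> (x + y)) (x + y)) - Re (cinner (T \<cdot> (x - y)) (x - y))"
      by (simp add: cinner_simps sym)
    also have "\<dots> \<le> c * (norm (x + y))\<^sup>2 + c * (norm (x - y))\<^sup>2"
      using c[of "x + y"] c[of "x - y"] by linarith
    also have "\<dots> = 4 * c * (norm x)\<^sup>2"
      by (simp add: norm_add_sq norm_diff_sq ny algebra_simps)
    also have "Re (cinner (T \<cdot> x) y) = norm x * norm (T \<cdot> x)"
      using False by (simp add: y_def cinner_simps cinner_self power2_eq_square)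
    finally show ?thesis
      using x by (simp add: power2_eq_square)
  qed (use assms in simp)
qed

lemma Re_quadratic_le: "\<bar>Re (cinner (T \<cdot> x) x)\<bar> \<le> norm T * (norm x)\<^sup>2"
proof -
  have "\<bar>Re (cinner (T \<cdot> x) x)\<bar> \<le> norm (T \<cdot> x) * norm x"
    by (meson abs_Re_le_cmod norm_cinner_le order_trans)
  also have "\<dots> \<le> norm T * norm x * norm x"
    by (intro mult_right_mono norm_ap_le) simp
  finally show ?thesis
    by (simp add: power2_eq_square)
qed

lemma pos_norm_diff: "selfadj T \<Longrightarrow> norm T \<le> c \<Longrightarrow> pos (c *\<^sub>R 1 - T)"
  and pos_norm_add: "selfadj T \<Longrightarrow> norm T \<le> c \<Longrightarrow> pos (c *\<^sub>R 1 + T)"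
proof -
  have "\<bar>Re (cinner (T \<cdot> x) x)\<bar> \<le> c * (norm x)\<^sup>2" if "norm T \<le> c" for x
    using Re_quadratic_le[of T x] mult_right_mono[OF that, of "(norm x)\<^sup>2"] by simp
  then show "selfadj T \<Longrightarrow> norm T \<le> c \<Longrightarrow> pos (c *\<^sub>R 1 - T)"
    and "selfadj T \<Longrightarrow> norm T \<le> c \<Longrightarrow> pos (c *\<^sub>R 1 + T)"
    by (auto intro!: posI simp: cinner_simps cinner_self abs_le_iff simp flip: of_real_power)
      (metis neg_le_iff_le add.inverse_inverse add_increasing2 add_uminus_conv_diff diff_ge_0_iff_ge
        le_add_same_cancel1 minus_le_iff add.commute)
qed

lemma pos_antisym: assumes "pos T" "pos (- T)" shows "T = 0"
proof -
  have "norm T \<le> 0"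
    using posD[OF assms(1)] posD[OF assms(2)]
    by (intro selfadj_norm_le pos_imp_selfadj assms) (simp_all add: cinner_simps eq_iff)
  then show ?thesis
    by simp
qed

lemma pos_norm_one_diff:
  assumes "pos T" "norm T \<le> 1" shows "norm (1 - T) \<le> 1"
proof (rule selfadj_norm_le)
  fix x
  have "Re (cinner (T \<cdot> x) x) \<le> (norm x)\<^sup>2"
    using Re_quadratic_le[of T x] mult_right_mono[OF assms(2), of "(norm x)\<^sup>2"] by simp
  then show "\<bar>Re (cinner ((1 - T) \<cdot> x) x)\<bar> \<le> 1 * (norm x)\<^sup>2"
    using posD[OF assms(1), of x] by (simp add: cinner_simps cinner_self)
qed (use assms pos_imp_selfadj in auto)

text \<open>A fixed point \<open>y\<close> satisfies \<open>2 y = A + y * y\<close>, that is,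
  \<open>1 - y\<close> is a square root of \<open>1 - A\<close>. The iterates are polynomials in
  \<open>A\<close> with nonnegative coefficients, which explains the comparison with the iteration
  for \<open>1\<close>.\<close>

fun sqrt_iter :: "'r::real_algebra \<Rightarrow> nat \<Rightarrow> 'r"
  where "sqrt_iter A 0 = 0"
  | "sqrt_iter A (Suc n) = (1/2) *\<^sub>R (A + sqrt_iter A n * sqrt_iter A n)"

text \<open>The iteration for \<open>1\<close> is a convergent scalar sequence that majorises the
  increments of the iteration for any contraction.\<close>

lemma sqrt_iter_scalar:
  "0 \<le> sqrt_iter (1::real) n" "sqrt_iter (1::real) n \<le> 1"
  "sqrt_iter (1::real) n \<le> sqrt_iter 1 (Suc n)"
proof -
  show 0: "0 \<le> sqrt_iter (1::real) n" for n
    by (induction n) auto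
  show 1: "sqrt_iter (1::real) n \<le> 1" for n
  proof (induction n)
    case (Suc n)
    then have "sqrt_iter (1::real) n * sqrt_iter 1 n \<le> 1"
      using 0 mult_le_one by blast
    then show ?case
      by simp
  qed simp
  have "0 \<le> (1 - sqrt_iter (1::real) n)\<^sup>2"
    by simp
  then show "sqrt_iter (1::real) n \<le> sqrt_iter 1 (Suc n)"
    by (simp add: power2_eq_square algebra_simps)
qed

lemma sqrt_iter_commute:
  fixes A :: "'r::real_algebra"
  assumes "A * B = B * A" shows "sqrt_iter A n * B = B * sqrt_iter A n"
proof (induction n)
  case (Suc n)
  have "sqrt_iter A n * sqrt_iter A n * B = B * (sqrt_iter A n * sqrt_iter A n)"
    by (metis Suc mult.assoc)
  then show ?case
    using assms by (simp add: distrib_left distrib_right)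
qed simp

lemma sqrt_iter_norm:
  fixes A :: "'r::real_normed_algebra"
  assumes "norm A \<le> 1" shows "norm (sqrt_iter A n) \<le> norm A"
proof (induction n)
  case (Suc n)
  have "norm (sqrt_iter A n * sqrt_iter A n) \<le> norm A * 1"
    using Suc assms by (intro order.trans[OF norm_mult_ineq] mult_mono) auto
  then show ?case
    using norm_triangle_ineq[of A "sqrt_iter A n * sqrt_iter A n"] by simp
qed simp

lemma sqrt_iter_increment:
  fixes A :: "'r::real_normed_algebra"
  assumes "norm A \<le> 1"
  shows "norm (sqrt_iter A n) \<le> sqrt_iter 1 n"
    and "norm (sqrt_iter A (Suc n) - sqrt_iter A n) \<le> sqrt_iter 1 (Suc n) - sqrt_iter 1 n"
proof -
  show n: "norm (sqrt_iter A n) \<le> sqrt_iter 1 n" for n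
  proof (induction n)
    case (Suc n)
    have "norm (sqrt_iter A n * sqrt_iter A n) \<le> sqrt_iter 1 n * sqrt_iter 1 n"
      using Suc sqrt_iter_scalar(1)[of n] by (intro order.trans[OF norm_mult_ineq] mult_mono) auto
    then show ?case
      using norm_triangle_ineq[of A "sqrt_iter A n * sqrt_iter A n"] assms by simp
  qed simp
  show "norm (sqrt_iter A (Suc n) - sqrt_iter A n) \<le> sqrt_iter 1 (Suc n) - sqrt_iter 1 n"
  proof (induction n)
    case (Suc n)
    define y z where "y = sqrt_iter A (Suc n)" and "z = sqrt_iter A n"
    define s t where "s = sqrt_iter (1::real) (Suc n)" and "t = sqrt_iter (1::real) n"
    have "A * z = z * A"
      unfolding z_def using sqrt_iter_commute[of A A n] by simp
    then have "y * z = z * y"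
      unfolding y_def z_def by (intro sqrt_iter_commute) simp
    \<comment> \<open>Consecutive iterates commute, so the difference of squares factors exactly as
      it does for the scalars \<open>s\<close> and \<open>t\<close>.\<close>
    then have yz: "(y + z) * (y - z) = y * y - z * z"
      by (simp add: algebra_simps)
    have y: "y = (1/2) *\<^sub>R (A + z * z)"
      by (simp add: y_def z_def)
    have "sqrt_iter A (Suc (Suc n)) - y = (1/2) *\<^sub>R (A + y * y) - y"
      by (simp add: y_def)
    also have "\<dots> = (1/2) *\<^sub>R (A + y * y) - (1/2) *\<^sub>R (A + z * z)"
      by (simp only: y[symmetric])
    also have "\<dots> = (1/2) *\<^sub>R ((y + z) * (y - z))"
      unfolding yz by (simp flip: scaleR_diff_right)
    also have "norm \<dots> \<le> 1/2 * ((norm y + norm z) * norm (y - z))"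
      by (simp add: mult_right_mono[OF norm_triangle_ineq] order_trans[OF norm_mult_ineq])
    also have "\<dots> \<le> 1/2 * ((s + t) * (s - t))"
      using n[of n] n[of "Suc n"] Suc unfolding s_def t_def y_def z_def
      by (intro mult_left_mono mult_mono add_mono) (auto intro!: add_nonneg_nonneg sqrt_iter_scalar)
    also have "\<dots> = sqrt_iter 1 (Suc (Suc n)) - s"
      by (simp add: s_def t_def algebra_simps)
    finally show ?case
      unfolding y_def s_def .
  qed (use assms in simp)
qed

lemma sqrt_iter_convergent:
  fixes A :: "'r::{real_normed_algebra,banach}"
  assumes "norm A \<le> 1" shows "convergent (sqrt_iter A)"
proof -
  have "incseq (sqrt_iter (1::real))"
    by (rule incseq_SucI) (rule sqrt_iter_scalar)
  then have "convergent (sqrt_iter (1::real))"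
    using sqrt_iter_scalar(1,2)
    by (intro Bseq_mono_convergent BseqI'[where K = 1]) (auto simp: incseq_def)
  then have C: "Cauchy (sqrt_iter (1::real))"
    by (simp add: convergent_Cauchy)
  have incr: "norm (sqrt_iter A (n + k) - sqrt_iter A n) \<le> sqrt_iter 1 (n + k) - sqrt_iter 1 n" for n k
  proof (induction k)
    case (Suc k)
    then show ?case
      using sqrt_iter_increment(2)[OF assms, of "n + k"]
        norm_triangle_ineq[of "sqrt_iter A (n + Suc k) - sqrt_iter A (n + k)" "sqrt_iter A (n + k) - sqrt_iter A n"]
      by (simp del: sqrt_iter.simps)
  qed simp
  have "Cauchy (sqrt_iter A)"
  proof (rule metric_CauchyI)
    fix e :: real assume "e > 0"
    then obtain N where N: "\<And>m n. m \<ge> N \<Longrightarrow> n \<ge> N \<Longrightarrow> dist (sqrt_iter (1::real) m) (sqrt_iter 1 n) < e"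
      using C by (meson metric_CauchyD)
    have "dist (sqrt_iter A m) (sqrt_iter A n) < e" if "N \<le> n" "n \<le> m" for m n
      using N[of m n] incr[of n "m - n"] that by (simp add: dist_norm)
    then show "\<exists>M. \<forall>m\<ge>M. \<forall>n\<ge>M. dist (sqrt_iter A m) (sqrt_iter A n) < e"
      by (metis dist_commute nle_le)
  qed
  then show ?thesis
    by (rule Cauchy_convergent)
qed


section \<open>Von Neumann algebras\<close>

text \<open>\<open>C\<close> plays the role of the commutant. Its members are not assumed
  adjointable, so they remain in the larger type of bounded operators and commutation is stated
  pointwise. In this form membership in \<open>A\<close> visibly passes to strong limits.\<close>

locale vn_algebra =
  fixes A :: "'a::chilbert_space cop set" and C :: "('a \<Rightarrow>\<^sub>L 'a) set"
  assumes C: "C \<subseteq> bounded_ops"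
    and mem_iff: "T \<in> A \<longleftrightarrow> (\<forall>S\<in>C. \<forall>x. S (T \<cdot> x) = T \<cdot> S x)"
    and star_closed: "T \<in> A \<Longrightarrow> star T \<in> A"
begin

lemma zero_closed: "0 \<in> A"
  and one_closed: "1 \<in> A"
  and add_closed: "S \<in> A \<Longrightarrow> T \<in> A \<Longrightarrow> S + T \<in> A"
  and diff_closed: "S \<in> A \<Longrightarrow> T \<in> A \<Longrightarrow> S - T \<in> A"
  and minus_closed: "T \<in> A \<Longrightarrow> - T \<in> A"
  and mult_closed: "S \<in> A \<Longrightarrow> T \<in> A \<Longrightarrow> S * T \<in> A"
  and scaleR_closed: "T \<in> A \<Longrightarrow> r *\<^sub>R T \<in> A"
  using mem_iff by (auto simp: blinfun.bilinear_simps)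

lemma cc_closed: "cc c \<in> A"
  using C by (auto simp: mem_iff bounded_ops_def)

lemma power_closed: "T \<in> A \<Longrightarrow> T ^ n \<in> A"
  by (induction n) (auto intro: one_closed mult_closed)

lemmas closed_intros = zero_closed one_closed add_closed diff_closed minus_closed mult_closed
  scaleR_closed cc_closed power_closed star_closed

lemma limit_closed:
  assumes "\<And>n. X n \<in> A" "\<And>x. (\<lambda>n. X n \<cdot> x) \<longlonglongrightarrow> L \<cdot> x" shows "L \<in> A"
  unfolding mem_iff
proof safe
  fix S x assume S: "S \<in> C"
  have "(\<lambda>n. S (X n \<cdot> x)) \<longlonglongrightarrow> S (L \<cdot> x)"
    by (rule bounded_linear.tendsto[OF blinfun.bounded_linear_right assms(2)])
  moreover have "(\<lambda>n. X n \<cdot> S x) \<longlonglongrightarrow> L \<cdot> S x"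
    by (rule assms(2))
  moreover have "S (X n \<cdot> x) = X n \<cdot> S x" for n
    using assms(1) S mem_iff by blast
  ultimately show "S (L \<cdot> x) = L \<cdot> S x"
    by (simp add: LIMSEQ_unique)
qed

lemma closed_A: "closed A"
  unfolding closed_sequential_limits
proof safe
  show "l \<in> A" if "\<forall>n. X n \<in> A" "X \<longlonglongrightarrow> l" for X l
    by (rule limit_closed[of X]) (use that tendsto_ap in auto)
qed

text \<open>Besides existence, the point is the estimate of \<open>norm (1 - s)\<close>: for
  \<open>B\<close> of second order in a parameter, the root differs from \<open>1\<close> only in
  second order. Commutation with \<open>s\<close> is inherited from the iterates.\<close>

lemma sqrt_near_one:
  assumes "B \<in> A" "selfadj B" "norm B \<le> 1"
  obtains s where "s \<in> A" "pos s" "s * s = 1 - B" "norm (1 - s) \<le> norm B"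
    "\<And>T. T * B = B * T \<Longrightarrow> T * s = s * T"
proof -
  obtain y where y: "sqrt_iter B \<longlonglongrightarrow> y"
    using sqrt_iter_convergent[OF assms(3)] by (auto simp: convergent_def)
  have yA: "y \<in> A"
  proof -
    have "sqrt_iter B n \<in> A" for n
      by (induction n) (simp_all add: closed_intros assms)
    then show ?thesis
      using y closed_sequentially[OF closed_A] by blast
  qed
  have "star (sqrt_iter B n) = sqrt_iter B n" for n
    by (induction n) (simp_all add: assms)
  then have sy: "selfadj y"
    using tendsto_star[OF y] y by (simp add: LIMSEQ_unique)
  have ny: "norm y \<le> norm B"
    using tendsto_norm[OF y] sqrt_iter_norm[OF assms(3)] by (intro LIMSEQ_le_const2) auto
  have "(\<lambda>n. sqrt_iter B (Suc n)) \<longlonglongrightarrow> (1/2) *\<^sub>R (B + y * y)"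
    unfolding sqrt_iter.simps by (intro tendsto_intros y)
  then have e: "y = (1/2) *\<^sub>R (B + y * y)"
    using y LIMSEQ_unique LIMSEQ_Suc by blast
  have "2 *\<^sub>R y = 2 *\<^sub>R ((1/2) *\<^sub>R (B + y * y))"
    by (simp only: e[symmetric])
  then have "y + y = B + y * y"
    by (simp add: scaleR_2)
  then have 1: "(1 - y) * (1 - y) = 1 - B"
    by (simp add: algebra_simps)
  have 2: "pos (1 - y)"
    using pos_norm_diff[OF sy, of 1] ny assms(3) by simp
  have 3: "T * (1 - y) = (1 - y) * T" if "T * B = B * T" for T
  proof -
    have "(\<lambda>n. sqrt_iter B n * T) \<longlonglongrightarrow> y * T" "(\<lambda>n. T * sqrt_iter B n) \<longlonglongrightarrow> T * y"
      by (intro tendsto_intros y)+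
    moreover have "sqrt_iter B n * T = T * sqrt_iter B n" for n
      using that by (intro sqrt_iter_commute) simp
    ultimately have "y * T = T * y"
      by (simp add: LIMSEQ_unique)
    then show ?thesis
      by (simp add: algebra_simps)
  qed
  show ?thesis
    by (rule that[OF _ 2 1 _ 3]) (use yA ny in \<open>auto intro: diff_closed one_closed\<close>)
qed

lemma sqrt_exists:
  assumes "T \<in> A" "pos T"
  obtains s where "s \<in> A" "pos s" "s * s = T" "\<And>B. B * T = T * B \<Longrightarrow> B * s = s * B"
proof (cases "T = 0")
  case True
  then show ?thesis
    using that[of 0] by (simp add: zero_closed pos_zero)
next
  case False
  define r where "r = norm T"
  have r: "r > 0"
    using False by (simp add: r_def)
  define B where "B = 1 - (1/r) *\<^sub>R T"
  have "norm B \<le> 1"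
    unfolding B_def using r by (intro pos_norm_one_diff pos_scaleR assms) (simp_all add: r_def)
  moreover have "B \<in> A" "selfadj B"
    using assms pos_imp_selfadj[OF assms(2)] unfolding B_def by (simp_all add: closed_intros)
  ultimately obtain s where s: "s \<in> A" "pos s" "s * s = 1 - B"
      "\<And>T. T * B = B * T \<Longrightarrow> T * s = s * T"
    using sqrt_near_one by metis
  show ?thesis
  proof
    show "sqrt r *\<^sub>R s \<in> A" "pos (sqrt r *\<^sub>R s)"
      using s(1,2) r by (simp_all add: closed_intros pos_scaleR)
    show "sqrt r *\<^sub>R s * sqrt r *\<^sub>R s = T"
      using r by (simp add: s(3) B_def)
    show "D * sqrt r *\<^sub>R s = sqrt r *\<^sub>R s * D" if "D * T = T * D" for D
      using that s(4)[of D] by (simp add: B_def algebra_simps)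
  qed
qed

end


section \<open>Spectral projections\<close>

lemma power_selfadj: "selfadj B \<Longrightarrow> selfadj (B ^ n)"
  by (simp add: star_power)

lemma cinner_power:
  assumes "selfadj B" shows "cinner (B ^ m \<cdot> x) (B ^ n \<cdot> y) = cinner (B ^ (m + n) \<cdot> x) y"
proof -
  have "cinner (B ^ m \<cdot> x) (B ^ n \<cdot> y) = cinner (B ^ n \<cdot> B ^ m \<cdot> x) y"
    using power_selfadj[OF assms, of n] by (metis cinner_star)
  also have "B ^ n \<cdot> B ^ m \<cdot> x = B ^ (m + n) \<cdot> x"
    by (metis ap_simps(6) power_add add.commute)
  finally show ?thesis .
qed

lemma power_pos:
  assumes "pos B" shows "pos (B ^ n)"
proof (rule posI)
  have sB: "selfadj B"
    by (rule pos_imp_selfadj[OF assms])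
  then show "selfadj (B ^ n)"
    by (rule power_selfadj)
  fix x
  obtain m where "n = m + m \<or> n = Suc m + m"
    by (metis add_Suc mult_2 oddE evenE Suc_eq_plus1)
  then show "0 \<le> Re (cinner (B ^ n \<cdot> x) x)"
  proof
    assume "n = m + m"
    then show ?thesis
      using cinner_power[OF sB, of m x m x]
      by (metis Re_complex_of_real cinner_self zero_le_power2)
  next
    assume "n = Suc m + m"
    then show ?thesis
      using cinner_power[OF sB, of "Suc m" x m x] posD[OF assms, of "B ^ m \<cdot> x"] by simp
  qed
qed

context vn_algebra
begin

text \<open>The projection onto the kernel of \<open>T\<close> is the strong limit of the powers of \<open>1 - T\<^sup>2\<close>.\<close>

lemma kernel_projection_contraction:
  assumes T: "T \<in> A" "selfadj T" "norm T \<le> 1"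
  obtains q where "q \<in> A" "selfadj q" "q * q = q" "T * q = 0" "q * T = 0"
    "\<And>x. T \<cdot> x = 0 \<Longrightarrow> q \<cdot> x = x"
proof -
  define B where "B = 1 - T * T"
  have BA: "B \<in> A"
    using T by (simp add: B_def closed_intros)
  have sB: "selfadj B"
    using T by (simp add: B_def)
  have nT: "norm (T * T) \<le> 1"
    using T mult_mono[of "norm T" 1 "norm T" 1] norm_mult_ineq[of T T] by simp
  have pT: "pos (T * T)"
    using pos_star_mult[of T] T by simp
  have pB: "pos B"
    using pos_norm_diff[of "T * T" 1] nT T by (simp add: B_def)
  have nB: "norm B \<le> 1"
    unfolding B_def by (rule pos_norm_one_diff[OF pT nT])
  have "B * T = T * B"
    by (simp add: B_def left_diff_distrib right_diff_distrib mult.assoc)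
  then have com: "T * B ^ n = B ^ n * T" for n
    using power_commuting_commutes by metis
  have npow: "norm (B ^ n \<cdot> x) \<le> norm x" for n x
  proof (induction n)
    case (Suc n)
    have "norm (B \<cdot> B ^ n \<cdot> x) \<le> 1 * norm (B ^ n \<cdot> x)"
      using nB by (intro order_trans[OF norm_ap_le] mult_right_mono) auto
    then show ?case
      using Suc by simp
  qed simp
  \<comment> \<open>These numbers decrease by the form of the positive operator \<open>B ^ n\<close>
    at \<open>T \<cdot> x\<close>, so they converge. The squared distance of
    \<open>B ^ m \<cdot> x\<close> and \<open>B ^ n \<cdot> x\<close> is a combination of three of
    them, with indices \<open>2 m\<close>, \<open>m + n\<close> and \<open>2 n\<close>, and so the
    vectors form a Cauchy sequence.\<close>
  define a where "a x n = Re (cinner (B ^ n \<cdot> x) x)" for x n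
  have "a x (Suc n) \<le> a x n" for x n
  proof -
    have "B ^ Suc n = B ^ n - T * B ^ n * T"
      by (simp add: com mult.assoc) (simp add: B_def right_diff_distrib power_commutes[symmetric])
    then have "a x n - a x (Suc n) = Re (cinner (B ^ n \<cdot> (T \<cdot> x)) (T \<cdot> x))"
      using T(2) by (simp add: a_def cinner_simps cinner_star' del: power_Suc)
    then show ?thesis
      using posD[OF power_pos[OF pB, of n], of "T \<cdot> x"] by simp
  qed
  then have "decseq (a x)" for x
    by (intro decseq_SucI)
  moreover have "0 \<le> a x n" for x n
    unfolding a_def by (rule posD[OF power_pos[OF pB]])
  ultimately have "convergent (a x)" for x
    by (metis decseq_convergent convergent_def)
  then have Ca: "Cauchy (a x)" for x
    by (rule convergent_Cauchy)
  have "Cauchy (\<lambda>n. B ^ n \<cdot> x)" for x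
  proof (rule metric_CauchyI)
    fix e :: real assume e: "e > 0"
    then obtain N where N: "\<And>m n. m \<ge> N \<Longrightarrow> n \<ge> N \<Longrightarrow> dist (a x m) (a x n) < e\<^sup>2 / 2"
      using metric_CauchyD[OF Ca, of "e\<^sup>2 / 2" x] by (metis half_gt_zero zero_less_power)
    have "dist (B ^ m \<cdot> x) (B ^ n \<cdot> x) < e" if "m \<ge> N" "n \<ge> N" for m n
    proof -
      have "(norm (B ^ m \<cdot> x - B ^ n \<cdot> x))\<^sup>2 = a x (m + m) - 2 * a x (m + n) + a x (n + n)"
        unfolding norm_diff_sq a_def cinner_power[OF sB, symmetric] by (simp add: cinner_self)
      also have "\<dots> < e\<^sup>2"
        using N[of "m + m" "m + n"] N[of "n + n" "m + n"] that unfolding dist_real_def by linarith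
      finally show ?thesis
        using e unfolding dist_norm by (meson less_eq_real_def power_less_imp_less_base)
    qed
    then show "\<exists>M. \<forall>m\<ge>M. \<forall>n\<ge>M. dist (B ^ m \<cdot> x) (B ^ n \<cdot> x) < e"
      by blast
  qed
  then have "convergent (\<lambda>n. B ^ n \<cdot> x)" for x
    by (simp add: Cauchy_convergent)
  then obtain Q where Q: "\<And>x. (\<lambda>n. B ^ n \<cdot> x) \<longlonglongrightarrow> Q x"
    unfolding convergent_def by metis
  have bl: "bounded_linear Q"
  proof (rule bounded_linear_intro[where K = 1])
    fix x y and r :: real
    show "Q (x + y) = Q x + Q y"
      using tendsto_add[OF Q[of x] Q[of y]] Q[of "x + y"] by (simp add: LIMSEQ_unique)
    show "Q (r *\<^sub>R x) = r *\<^sub>R Q x"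
      using tendsto_scaleR[OF tendsto_const[of r] Q[of x]] Q[of "r *\<^sub>R x"] by (simp add: LIMSEQ_unique)
    show "norm (Q x) \<le> norm x * 1"
      using tendsto_norm[OF Q[of x]] npow by (intro LIMSEQ_le_const2) auto
  qed
  have Qc: "Q (c *\<^sub>C x) = c *\<^sub>C Q x" for c x
    using bounded_linear.tendsto[OF bounded_linear_scaleC[of c] Q[of x]] Q[of "c *\<^sub>C x"]
    by (simp add: LIMSEQ_unique)
  have adj: "cinner (Q x) y = cinner x (Q y)" for x y
  proof -
    have "(\<lambda>n. cinner (B ^ n \<cdot> x) y) \<longlonglongrightarrow> cinner (Q x) y"
      by (intro tendsto_cinner Q tendsto_const)
    moreover have "(\<lambda>n. cinner x (B ^ n \<cdot> y)) \<longlonglongrightarrow> cinner x (Q y)"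
      by (intro tendsto_cinner Q tendsto_const)
    moreover have "cinner (B ^ n \<cdot> x) y = cinner x (B ^ n \<cdot> y)" for n
      by (metis cinner_star power_selfadj[OF sB])
    ultimately show ?thesis
      by (simp add: LIMSEQ_unique)
  qed
  define q where "q = Cop (Blinfun Q)"
  have "blf q = Blinfun Q"
    unfolding q_def
    by (subst Cop_inverse)
      (auto simp: bounded_ops_def is_adjoint_def bounded_linear_Blinfun_apply[OF bl] Qc adj
        intro!: exI[of _ "Blinfun Q"])
  then have q: "q \<cdot> x = Q x" for x
    by (simp add: ap_def bounded_linear_Blinfun_apply[OF bl])
  have sq: "selfadj q"
    by (rule starI) (simp add: q adj)
  have Bq: "B \<cdot> Q x = Q x" for x
  proof -
    have "(\<lambda>n. B ^ Suc n \<cdot> x) \<longlonglongrightarrow> Q x"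
      by (rule LIMSEQ_Suc[OF Q])
    moreover have "(\<lambda>n. B \<cdot> B ^ n \<cdot> x) \<longlonglongrightarrow> B \<cdot> Q x"
      unfolding ap_def[of B] by (intro bounded_linear.tendsto[OF blinfun.bounded_linear_right] Q)
    ultimately show ?thesis
      by (simp add: LIMSEQ_unique)
  qed
  have fix_Q: "Q x = x" if "B \<cdot> x = x" for x
  proof -
    have "B ^ n \<cdot> x = x" for n
      using that by (induction n) auto
    then show ?thesis
      using Q[of x] by (simp add: LIMSEQ_const_iff)
  qed
  have Tq: "T * q = 0"
  proof (rule cop_eqI)
    fix x
    have "T \<cdot> T \<cdot> Q x = 0"
      using Bq[of x] by (simp add: B_def)
    then have "(norm (T \<cdot> Q x))\<^sup>2 = 0"
      using norm_ap_sq[of T "Q x"] T by simp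
    then show "(T * q) \<cdot> x = 0 \<cdot> x"
      by (simp add: q)
  qed
  show ?thesis
  proof
    show "q \<in> A"
      by (rule limit_closed[of "\<lambda>n. B ^ n"]) (simp_all add: q Q BA closed_intros)
    show "q * q = q"
      by (rule cop_eqI) (simp add: q fix_Q Bq)
    show "q * T = 0"
      using arg_cong[OF Tq, of star] sq T by simp
    show "q \<cdot> x = x" if "T \<cdot> x = 0" for x
      using that by (simp add: q fix_Q B_def)
  qed (fact sq Tq)+
qed

lemma kernel_projection:
  assumes T: "T \<in> A" "selfadj T"
  obtains q where "q \<in> A" "selfadj q" "q * q = q" "T * q = 0" "q * T = 0"
    "\<And>x. T \<cdot> x = 0 \<Longrightarrow> q \<cdot> x = x"
proof -
  \<comment> \<open>The summand 1 keeps the scaling factor meaningful for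
    \<open>T = 0\<close>.\<close>
  define c where "c = inverse (norm T + 1)"
  have c: "c > 0"
    by (simp add: c_def add_nonneg_pos)
  have 3: "norm (c *\<^sub>R T) \<le> 1"
    by (simp add: c_def divide_simps not_less add_nonneg_nonneg)
  have 1: "c *\<^sub>R T \<in> A" and 2: "selfadj (c *\<^sub>R T)"
    using T by (simp_all add: closed_intros)
  show ?thesis
  proof (rule kernel_projection_contraction[OF 1 2 3])
    fix q assume q: "q \<in> A" "selfadj q" "q * q = q" "c *\<^sub>R T * q = 0" "q * c *\<^sub>R T = 0"
      and qk: "\<And>x. (c *\<^sub>R T) \<cdot> x = 0 \<Longrightarrow> q \<cdot> x = x"
    show thesis
    proof (rule that[OF q(1-3)])
      show "T * q = 0" "q * T = 0"
        using q(4,5) c by simp_all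
      show "q \<cdot> x = x" if "T \<cdot> x = 0" for x
        by (rule qk) (simp add: that)
    qed
  qed
qed

lemma kernel_projection_kills:
  assumes "\<And>x. T \<cdot> x = 0 \<Longrightarrow> q \<cdot> x = x" "T * S = 0"
  shows "q * S = S"
  using assms by (intro cop_eqI) (metis ap_simps(1,6))

text \<open>Here \<open>k\<close> is the absolute value of \<open>h\<close>. The parts
  \<open>p\<close> and \<open>n\<close> are algebraically evident; for their positivity
  \<open>k = p + n\<close> is compressed by the projection \<open>q\<close> onto the kernel of
  \<open>n\<close>, which fixes \<open>p\<close> because \<open>n * p = 0\<close>, and by
  \<open>1 - q\<close>.\<close>

lemma pos_neg_parts:
  assumes h: "h \<in> A" "selfadj h"
  obtains p n where "p \<in> A" "n \<in> A" "pos p" "pos n" "h = p - n" "p * n = 0" "n * p = 0"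
proof -
  have "pos (h * h)"
    using pos_star_mult[of h] h by simp
  then obtain k where k: "k \<in> A" "pos k" "k * k = h * h" and kh: "h * k = k * h"
    using sqrt_exists[of "h * h"] h by (metis mult.assoc mult_closed)
  have sk: "selfadj k"
    by (rule pos_imp_selfadj[OF k(2)])
  define p n where "p = (1/2) *\<^sub>R (k + h)" and "n = (1/2) *\<^sub>R (k - h)"
  have pA: "p \<in> A" "n \<in> A"
    using h k by (simp_all add: p_def n_def closed_intros)
  have sp: "selfadj p" "selfadj n"
    using h sk by (simp_all add: p_def n_def)
  have pn: "p * n = 0" "n * p = 0"
    using k(3) kh by (simp_all add: p_def n_def algebra_simps)
  have kpn: "k = p + n"
    by (simp add: p_def n_def flip: scaleR_add_right scaleR_2)
  have hpn: "h = p - n"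
    by (simp add: p_def n_def flip: scaleR_diff_right scaleR_2)
  obtain q where q: "q \<in> A" "selfadj q" "q * q = q" "n * q = 0" "q * n = 0"
      and qk: "\<And>x. n \<cdot> x = 0 \<Longrightarrow> q \<cdot> x = x"
    using kernel_projection[OF pA(2) sp(2)] by metis
  have qp: "q * p = p"
    by (rule kernel_projection_kills[OF qk pn(2)])
  have pq: "p * q = p"
    using arg_cong[OF qp, of star] q sp by simp
  have "p = star q * k * q"
    using q qp pq by (simp add: kpn distrib_left distrib_right mult.assoc)
  then have "pos p"
    using pos_conj[OF k(2)] by metis
  have "n = star (1 - q) * k * (1 - q)"
    using q qp pq by (simp add: kpn distrib_left distrib_right left_diff_distrib right_diff_distrib mult.assoc)
  then have "pos n"
    using pos_conj[OF k(2)] by metis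
  show ?thesis
    by (rule that[OF pA \<open>pos p\<close> \<open>pos n\<close> hpn pn])
qed

text \<open>\<open>e\<close> is the support of the positive part \<open>T\<close> of
  \<open>S - c\<close>. This part is nonzero since \<open>c = norm S / 2\<close> lies strictly below
  the norm of \<open>S\<close>.\<close>

lemma dominated_projection:
  assumes S: "S \<in> A" "pos S" "S \<noteq> 0"
  obtains e c where "e \<in> A" "selfadj e" "e * e = e" "e \<noteq> 0" "c > 0" "pos (S - c *\<^sub>R e)"
proof -
  have sS: "selfadj S"
    by (rule pos_imp_selfadj[OF S(2)])
  define c where "c = norm S / 2"
  have c: "c > 0"
    using S by (simp add: c_def)
  have "S - c *\<^sub>R 1 \<in> A" "selfadj (S - c *\<^sub>R 1)"
    using S sS by (simp_all add: closed_intros)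
  then obtain T N where TN: "T \<in> A" "N \<in> A" "pos T" "pos N" "S - c *\<^sub>R 1 = T - N" "T * N = 0" "N * T = 0"
    using pos_neg_parts by metis
  have sT: "selfadj T" and sN: "selfadj N"
    using TN pos_imp_selfadj by auto
  have "T \<noteq> 0"
  proof
    assume "T = 0"
    then have "N = c *\<^sub>R 1 - S"
      using TN(5) by (simp add: algebra_simps)
    then have "pos (c *\<^sub>R 1 - S)"
      using TN(4) by simp
    then have "Re (cinner (S \<cdot> x) x) \<le> c * (norm x)\<^sup>2" for x
      using posD[of "c *\<^sub>R 1 - S" x] by (simp add: cinner_simps cinner_self)
    then have "norm S \<le> c"
      using c posD[OF S(2)] by (intro selfadj_norm_le sS) auto
    then show False
      using S(3) by (simp add: c_def)
  qed
  obtain q where q: "q \<in> A" "selfadj q" "q * q = q" "T * q = 0" "q * T = 0"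
      and qk: "\<And>x. T \<cdot> x = 0 \<Longrightarrow> q \<cdot> x = x"
    using kernel_projection[OF TN(1) sT] by metis
  define e where "e = 1 - q"
  have eA: "e \<in> A" "selfadj e" "e * e = e"
    using q by (simp_all add: e_def closed_intros algebra_simps)
  have qN: "q * N = N"
    by (rule kernel_projection_kills[OF qk TN(6)])
  have Nq: "N * q = N"
    using arg_cong[OF qN, of star] q sN by simp
  have Se: "S = T - N + c *\<^sub>R 1"
    using TN(5) by (simp add: algebra_simps)
  have "q * (T - N + c *\<^sub>R 1) * q = c *\<^sub>R q - N"
    using q(2-5) qN Nq by (simp add: distrib_left distrib_right left_diff_distrib right_diff_distrib)
  \<comment> \<open>Since \<open>q\<close> kills \<open>T\<close> and fixes \<open>N\<close>, the
    operator \<open>c q - N\<close> left over from \<open>S - c e - T\<close> is the compression of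
    \<open>S\<close> by \<open>q\<close>, hence positive.\<close>
  then have "S - c *\<^sub>R e = T + star q * S * q"
    unfolding Se e_def q(2) by (simp add: scaleR_diff_right)
  then have "pos (S - c *\<^sub>R e)"
    using pos_add[OF TN(3) pos_conj[OF S(2), of q]] by simp
  moreover have "e \<noteq> 0"
    using \<open>T \<noteq> 0\<close> q(5) by (auto simp: e_def)
  ultimately show ?thesis
    using that eA c by blast
qed

end


section \<open>Automatic continuity of derivations\<close>

definition reT :: "'a::chilbert_space cop \<Rightarrow> 'a cop"
  where "reT T = (1/2) *\<^sub>R (T + star T)"

definition imT :: "'a::chilbert_space cop \<Rightarrow> 'a cop"
  where "imT T = reT (cc (- \<i>) * T)"

lemma selfadj_reT: "selfadj (reT T)"
  by (simp add: reT_def add.commute)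

lemma selfadj_imT: "selfadj (imT T)"
  by (simp add: imT_def selfadj_reT)

lemma reT_add: "reT (S + T) = reT S + reT T"
  by (simp add: reT_def algebra_simps)

lemma reT_scaleR: "reT (r *\<^sub>R T) = r *\<^sub>R reT T"
  by (simp add: reT_def algebra_simps)

lemma norm_reT_le: "norm (reT T) \<le> norm T"
  using norm_triangle_ineq[of T "star T"] by (simp add: reT_def)

lemma norm_cc_mult_le: "norm (cc c * T) \<le> cmod c * norm T"
  by (intro order_trans[OF norm_mult_ineq] mult_right_mono norm_cc_le) simp

lemma norm_imT_le: "norm (imT T) \<le> norm T"
  using norm_reT_le[of "cc (- \<i>) * T"] norm_cc_mult_le[of "- \<i>" T] by (simp add: imT_def)

lemma Re_cinner_reT: "Re (cinner (reT T \<cdot> x) x) = Re (cinner (T \<cdot> x) x)"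
proof -
  have "Re (cinner (star T \<cdot> x) x) = Re (cinner (T \<cdot> x) x)"
    by (metis Re_cinner_commute cinner_star)
  then show ?thesis
    by (simp add: reT_def cinner_simps)
qed

lemma re_im_decomp: "T = reT T + cc \<i> * imT T"
proof -
  have "cc \<i> * (cc (- \<i>) * T) = T" "cc \<i> * (cc \<i> * star T) = - star T"
    by (simp_all add: cc_simps cc_minus flip: mult.assoc cc_simps(2))
  then have "cc \<i> * imT T = (1/2) *\<^sub>R (T - star T)"
    by (simp add: imT_def reT_def cc_commute[of "star T"] distrib_left)
  then show ?thesis
    by (simp add: reT_def flip: scaleR_add_right scaleR_2)
qed

locale vn_derivation = vn_algebra A C for A :: "'a::chilbert_space cop set" and C +
  fixes D :: "'a cop \<Rightarrow> 'a cop"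
  assumes D_closed: "x \<in> A \<Longrightarrow> D x \<in> A"
    and D_add: "x \<in> A \<Longrightarrow> y \<in> A \<Longrightarrow> D (x + y) = D x + D y"
    and D_cc: "x \<in> A \<Longrightarrow> D (cc c * x) = cc c * D x"
    and D_mult: "x \<in> A \<Longrightarrow> y \<in> A \<Longrightarrow> D (x * y) = D x * y + x * D y"
begin

lemma D_scaleR: "x \<in> A \<Longrightarrow> D (r *\<^sub>R x) = r *\<^sub>R D x"
  using D_cc[of x "of_real r"] by (simp add: cc_simps)

lemma D_minus: "x \<in> A \<Longrightarrow> D (- x) = - D x"
  using D_scaleR[of x "-1"] by simp

lemma D_diff: "x \<in> A \<Longrightarrow> y \<in> A \<Longrightarrow> D (x - y) = D x - D y"
  using D_add[of x "- y"] by (simp add: D_minus closed_intros)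

lemma D_one: "D 1 = 0"
  using D_mult[OF one_closed one_closed] by simp

text \<open>Near-maximal vectors of \<open>a\<close> are almost annihilated by the square root of
  \<open>norm a - a\<close>, so the vector states at which \<open>a\<close> attains its norm nearly kill \<open>D a\<close>.\<close>

lemma quadratic_form_bound:
  assumes a: "a \<in> A" "selfadj a"
  shows "\<exists>K\<ge>0. \<forall>x. norm x = 1 \<longrightarrow>
    \<bar>Re (cinner (D a \<cdot> x) x)\<bar> \<le> K * sqrt (norm a - Re (cinner (a \<cdot> x) x))"
proof -
  have "norm a *\<^sub>R 1 - a \<in> A" "pos (norm a *\<^sub>R 1 - a)"
    using a by (simp_all add: closed_intros pos_norm_diff)
  then obtain h where h: "h \<in> A" "pos h" "h * h = norm a *\<^sub>R 1 - a"
    using sqrt_exists by metis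
  have sh: "selfadj h"
    using h(2) by (rule pos_imp_selfadj)
  have "D (norm a *\<^sub>R 1 - a) = - D a"
    using a by (simp add: D_diff D_scaleR D_one closed_intros)
  \<comment> \<open>In the quadratic form each summand acquires a factor \<open>h \<cdot> x\<close>:
    one directly, the other after moving the self-adjoint \<open>h\<close> across the inner product.
    This accounts for the constant \<open>2 * norm (D h)\<close>.\<close>
  then have Da: "D a = - (D h * h + h * D h)"
    using D_mult[OF h(1) h(1)] h(3) by (metis minus_minus)
  show ?thesis
  proof (intro exI[of _ "2 * norm (D h)"] conjI allI impI)
    fix x :: 'a assume x: "norm x = 1"
    have "(norm (h \<cdot> x))\<^sup>2 = Re (cinner ((h * h) \<cdot> x) x)"
      using norm_ap_sq[of h x] sh by simp
    also have "\<dots> = norm a - Re (cinner (a \<cdot> x) x)"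
      by (simp only: h(3)) (simp add: cinner_simps cinner_self x)
    finally have hx: "norm (h \<cdot> x) = sqrt (norm a - Re (cinner (a \<cdot> x) x))"
      by (metis norm_ge_zero real_sqrt_unique)
    have 1: "cmod (cinner (D h \<cdot> h \<cdot> x) x) \<le> norm (D h) * norm (h \<cdot> x)"
      using norm_cinner_le[of "D h \<cdot> h \<cdot> x" x] norm_ap_le[of "D h" "h \<cdot> x"] x by simp
    have "cmod (cinner (D h \<cdot> x) (h \<cdot> x)) \<le> norm (D h \<cdot> x) * norm (h \<cdot> x)"
      by (rule norm_cinner_le)
    also have "\<dots> \<le> norm (D h) * norm (h \<cdot> x)"
      using norm_ap_le[of "D h" x] x by (simp add: mult_right_mono)
    finally have 2: "cmod (cinner (h \<cdot> D h \<cdot> x) x) \<le> norm (D h) * norm (h \<cdot> x)"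
      by (simp add: cinner_star sh)
    have "\<bar>Re (cinner (D a \<cdot> x) x)\<bar> = \<bar>Re (cinner (D h \<cdot> h \<cdot> x) x) + Re (cinner (h \<cdot> D h \<cdot> x) x)\<bar>"
      unfolding Da by (simp add: cinner_simps)
    also have "\<dots> \<le> cmod (cinner (D h \<cdot> h \<cdot> x) x) + cmod (cinner (h \<cdot> D h \<cdot> x) x)"
      by (intro order_trans[OF abs_triangle_ineq] add_mono abs_Re_le_cmod)
    also have "\<dots> \<le> 2 * norm (D h) * norm (h \<cdot> x)"
      using 1 2 by simp
    finally show "\<bar>Re (cinner (D a \<cdot> x) x)\<bar> \<le> 2 * norm (D h) * sqrt (norm a - Re (cinner (a \<cdot> x) x))"
      by (simp only: hx)
  qed simp
qed

text \<open>By \<open>selfadj_norm_le\<close> there is a unit vector at which the form of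
  \<open>a\<close> is within \<open>d\<close> of \<open>norm a\<close> or of
  \<open>- norm a\<close>. There the form of \<open>D a\<close> is at most
  \<open>K * sqrt d\<close>, so adding the real part of \<open>D a\<close> lowers the norm by no
  more than \<open>d + K * sqrt d\<close>. The constant \<open>K1\<close> serves the first sign, and
  \<open>K2\<close>, obtained from \<open>- a\<close>, the second.\<close>

lemma dissipative:
  assumes a: "a \<in> A" "selfadj a"
  shows "norm a \<le> norm (a + reT (D a))"
proof -
  obtain K1 where K1: "K1 \<ge> 0" "\<And>x. norm x = 1 \<Longrightarrow>
      \<bar>Re (cinner (D a \<cdot> x) x)\<bar> \<le> K1 * sqrt (norm a - Re (cinner (a \<cdot> x) x))"
    using quadratic_form_bound[OF a] by blast
  have "- a \<in> A" "selfadj (- a)"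
    using a by (simp_all add: closed_intros)
  then obtain K2 where K2: "K2 \<ge> 0" "\<And>x. norm x = 1 \<Longrightarrow>
      \<bar>Re (cinner (D a \<cdot> x) x)\<bar> \<le> K2 * sqrt (norm a + Re (cinner (a \<cdot> x) x))"
    using quadratic_form_bound[of "- a"] a by (auto simp: D_minus cinner_simps)
  define K where "K = K1 + K2"
  define T where "T = a + reT (D a)"
  have est: "norm a \<le> norm T + d + K * sqrt d" if d: "d > 0" for d
  proof (cases "d < norm a")
    case True
    have "\<not> (\<forall>x. \<bar>Re (cinner (a \<cdot> x) x)\<bar> \<le> (norm a - d) * (norm x)\<^sup>2)"
      using selfadj_norm_le[OF a(2), of "norm a - d"] True d by auto
    then obtain y where y: "\<bar>Re (cinner (a \<cdot> y) y)\<bar> > (norm a - d) * (norm y)\<^sup>2"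
      by (auto simp: not_le)
    then have y0: "norm y > 0"
      by auto
    define x where "x = (1 / norm y) *\<^sub>R y"
    have x: "norm x = 1"
      using y0 by (simp add: x_def)
    have ax: "\<bar>Re (cinner (a \<cdot> x) x)\<bar> > norm a - d"
      using y y0 by (simp add: x_def cinner_simps power2_eq_square field_simps abs_mult)
    have le: "\<bar>Re (cinner (a \<cdot> x) x)\<bar> \<le> norm a"
      using Re_quadratic_le[of a x] x by simp
    have "\<bar>Re (cinner (D a \<cdot> x) x)\<bar> \<le> K * sqrt d"
    proof (cases "Re (cinner (a \<cdot> x) x) \<ge> 0")
      case True
      have "K1 * sqrt (norm a - Re (cinner (a \<cdot> x) x)) \<le> K * sqrt d"
        using True ax le K1 K2 d by (intro mult_mono real_sqrt_le_mono) (auto simp: K_def)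
      then show ?thesis
        using K1(2)[OF x] by simp
    next
      case False
      have "K2 * sqrt (norm a + Re (cinner (a \<cdot> x) x)) \<le> K * sqrt d"
        using False ax le K1 K2 d by (intro mult_mono real_sqrt_le_mono) (auto simp: K_def)
      then show ?thesis
        using K2(2)[OF x] by simp
    qed
    moreover have "\<bar>Re (cinner (a \<cdot> x) x) + Re (cinner (D a \<cdot> x) x)\<bar> \<le> norm T"
      using Re_quadratic_le[of T x] x by (simp add: T_def cinner_simps Re_cinner_reT)
    ultimately show ?thesis
      using ax by linarith
  next
    case False
    then show ?thesis
      using d K1 K2 by (simp add: K_def add_increasing add_increasing2)
  qed
  have "norm a \<le> norm T"
  proof (rule tendsto_lowerbound)
    show "((\<lambda>d. norm T + d + K * sqrt d) \<longlongrightarrow> norm T) (at_right 0)"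
      by (auto intro!: tendsto_eq_intros)
    show "\<forall>\<^sub>F d in at_right 0. norm a \<le> norm T + d + K * sqrt d"
      using est by (auto intro: eventually_mono[OF eventually_at_right_less])
  qed simp
  then show ?thesis
    by (simp add: T_def)
qed

text \<open>The map \<open>reT \<circ> D\<close> leaves the real Banach space of self-adjoint
  elements invariant. A real multiple \<open>t D\<close> is again a derivation, so
  \<open>dissipative\<close> supplies the inequality for every \<open>t\<close>.\<close>

lemma real_part_bounded: "\<exists>M\<ge>0. \<forall>a\<in>A. selfadj a \<longrightarrow> norm (reT (D a)) \<le> M * norm a"
proof -
  define V where "V = {a \<in> A. selfadj a}"
  have "closed V"
    unfolding closed_sequential_limits
  proof safe
    fix X l assume X: "\<forall>n. X n \<in> V" "X \<longlonglongrightarrow> l"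
    then have "l \<in> A"
      using closed_sequentially[OF closed_A, of X l] by (auto simp: V_def)
    moreover have "(\<lambda>n. star (X n)) \<longlonglongrightarrow> star l"
      by (intro tendsto_intros X)
    then have "star l = l"
      using X by (simp add: V_def LIMSEQ_unique)
    ultimately show "l \<in> V"
      by (simp add: V_def)
  qed
  moreover have "subspace V"
    by (auto simp: V_def subspace_def closed_intros)
  ultimately have "\<exists>M\<ge>0. \<forall>a\<in>V. norm (reT (D a)) \<le> M * norm a"
  proof (rule dissipative_imp_bounded)
    show "reT (D x) \<in> V" if "x \<in> V" for x
      using that D_closed[of x] selfadj_reT[of "D x"] by (auto simp: V_def reT_def closed_intros)
    show "norm x \<le> norm (x + t *\<^sub>R reT (D x))" if "x \<in> V" for x t
    proof -
      interpret tD: vn_derivation A C "\<lambda>x. t *\<^sub>R D x"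
      proof
        show "t *\<^sub>R D (cc c * x) = cc c * t *\<^sub>R D x" if "x \<in> A" for c x
          using that by (simp add: D_cc)
      qed (simp_all add: closed_intros D_closed D_add D_mult scaleR_add_right)
      show ?thesis
        using tD.dissipative[of x] that by (simp add: V_def reT_scaleR)
    qed
  qed (auto simp: V_def D_add D_scaleR reT_add reT_scaleR)
  then show ?thesis
    by (auto simp: V_def)
qed

text \<open>\<open>- \<i> D\<close> is also a derivation, and its real part is the imaginary part of
  \<open>D\<close>. The factor 2 arises from splitting a general \<open>x\<close> into self-adjoint
  parts.\<close>

theorem bounded: "\<exists>M\<ge>0. \<forall>x\<in>A. norm (D x) \<le> M * norm x"
proof -
  interpret iD: vn_derivation A C "\<lambda>x. cc (- \<i>) * D x"
  proof
    fix x y c assume "x \<in> A" "y \<in> A"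
    then show "cc (- \<i>) * D (x * y) = cc (- \<i>) * D x * y + x * (cc (- \<i>) * D y)"
      by (simp add: D_mult distrib_left cc_commute[of x] flip: mult.assoc)
    show "cc (- \<i>) * D (cc c * x) = cc c * (cc (- \<i>) * D x)"
      using \<open>x \<in> A\<close> by (simp add: D_cc mult.commute flip: mult.assoc cc_simps(2))
  qed (simp_all add: closed_intros D_closed D_add distrib_left)
  obtain M1 where M1: "M1 \<ge> 0" "\<And>a. a \<in> A \<Longrightarrow> selfadj a \<Longrightarrow> norm (reT (D a)) \<le> M1 * norm a"
    using real_part_bounded by blast
  obtain M2 where M2: "M2 \<ge> 0" "\<And>a. a \<in> A \<Longrightarrow> selfadj a \<Longrightarrow> norm (imT (D a)) \<le> M2 * norm a"
    using iD.real_part_bounded unfolding imT_def by blast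
  have sa: "norm (D a) \<le> (M1 + M2) * norm a" if "a \<in> A" "selfadj a" for a
  proof -
    have "norm (D a) \<le> norm (reT (D a)) + norm (cc \<i> * imT (D a))"
      by (subst re_im_decomp) (rule norm_triangle_ineq)
    also have "\<dots> \<le> norm (reT (D a)) + norm (imT (D a))"
      using norm_cc_mult_le[of \<i> "imT (D a)"] by simp
    also have "\<dots> \<le> M1 * norm a + M2 * norm a"
      by (intro add_mono M1 M2 that)
    finally show ?thesis
      by (simp add: algebra_simps)
  qed
  have "norm (D x) \<le> (2 * (M1 + M2)) * norm x" if x: "x \<in> A" for x
  proof -
    have A: "reT x \<in> A" "imT x \<in> A" "cc \<i> * imT x \<in> A"
      using x by (simp_all add: reT_def imT_def closed_intros)
    have "D x = D (reT x) + cc \<i> * D (imT x)"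
      using D_add[OF A(1,3)] D_cc[OF A(2)] re_im_decomp[of x] by simp
    then have "norm (D x) \<le> norm (D (reT x)) + norm (cc \<i> * D (imT x))"
      by (metis norm_triangle_ineq)
    also have "\<dots> \<le> norm (D (reT x)) + norm (D (imT x))"
      using norm_cc_mult_le[of \<i> "D (imT x)"] by simp
    also have "\<dots> \<le> (M1 + M2) * norm (reT x) + (M1 + M2) * norm (imT x)"
      by (intro add_mono sa A selfadj_reT selfadj_imT)
    also have "\<dots> \<le> (M1 + M2) * norm x + (M1 + M2) * norm x"
      using M1 M2 by (intro add_mono mult_left_mono norm_reT_le norm_imT_le) auto
    finally show ?thesis
      by (simp add: algebra_simps)
  qed
  then show ?thesis
    using M1 M2 by (intro exI[of _ "2 * (M1 + M2)"]) auto
qed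

end


section \<open>Traces on corners\<close>

lemma eq_0_if_mult_bounded:
  fixes c :: real
  assumes "0 \<le> c" "\<And>n. real n * c \<le> B" shows "c = 0"
proof (rule ccontr)
  assume "c \<noteq> 0"
  then obtain n where "B < real n * c"
    using assms(1) reals_Archimedean3[of c] by auto
  then show False
    using assms(2)[of n] by simp
qed

lemma cc_ii_twice: "cc \<i> * (cc \<i> * x) = - x"
  using scaleC_of_real[of "-1"] by (intro cop_eqI) (simp add: scaleC_scaleC)

text \<open>The properties of \<open>x \<mapsto> \<tau> (e x e)\<close> on which the differentiation
  argument rests. \<open>f_swap\<close> is the trace property of the corner, since
  \<open>e x e y e\<close> is the product of \<open>e x e\<close> and \<open>e y e\<close>.\<close>

locale corner_trace = vn_algebra A C for A :: "'a::chilbert_space cop set" and C +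
  fixes e :: "'a cop" and f :: "'a cop \<Rightarrow> complex" and K :: real
  assumes e: "e \<in> A" "selfadj e" "e * e = e"
    and f_add: "x \<in> A \<Longrightarrow> y \<in> A \<Longrightarrow> f (x + y) = f x + f y"
    and f_cc: "x \<in> A \<Longrightarrow> f (cc c * x) = c * f x"
    and f_bound: "x \<in> A \<Longrightarrow> cmod (f x) \<le> K * norm x"
    and f_corner: "x \<in> A \<Longrightarrow> f (e * x * e) = f x"
    and f_swap: "x \<in> A \<Longrightarrow> y \<in> A \<Longrightarrow> f (x * e * y) = f (y * e * x)"
    and f_faithful: "x \<in> A \<Longrightarrow> f (x * e * star x) = 0 \<Longrightarrow> e * x * e = 0"
    and K: "0 \<le> K"
begin

lemma ee [simp]: "e * (e * x) = e * x"
  by (simp add: e flip: mult.assoc)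

lemma f_scaleR: "x \<in> A \<Longrightarrow> f (r *\<^sub>R x) = of_real r * f x"
  using f_cc[of x "of_real r"] by (simp add: cc_simps)

lemma f_minus: "x \<in> A \<Longrightarrow> f (- x) = - f x"
  using f_scaleR[of x "-1"] by simp

lemma f_diff: "x \<in> A \<Longrightarrow> y \<in> A \<Longrightarrow> f (x - y) = f x - f y"
  using f_add[of x "- y"] by (simp add: f_minus closed_intros)

lemma f_zero: "f 0 = 0"
  using f_scaleR[OF zero_closed, of 0] by simp

lemma f_left: "x \<in> A \<Longrightarrow> f (e * x) = f x"
  and f_right: "x \<in> A \<Longrightarrow> f (x * e) = f x"
  using f_corner[of "e * x"] f_corner[of "x * e"] f_corner[of x] e
  by (simp_all add: closed_intros mult.assoc)

lemma f_left_kill: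
  assumes "x \<in> A" shows "f ((1 - e) * x) = 0"
proof -
  have "e * ((1 - e) * x) = 0"
    by (simp add: left_diff_distrib right_diff_distrib)
  then show ?thesis
    using f_left[of "(1 - e) * x"] assms e by (simp add: closed_intros f_zero)
qed

text \<open>The trace property is available only across a factor \<open>e\<close>. Because
  \<open>u\<close> commutes with \<open>e\<close>, such a factor can be inserted next to
  \<open>u\<close> and removed after the swap.\<close>

lemma f_conj:
  assumes "u \<in> A" "v \<in> A" "X \<in> A" "e * u = u * e" "v * u = 1"
  shows "f (u * X * v) = f X"
proof -
  have "f (u * X * v) = f (e * (u * X * v))"
    using assms by (simp add: f_left closed_intros)
  also have "\<dots> = f (u * e * (X * v))"
    using assms(4) by (simp flip: mult.assoc)
  also have "\<dots> = f (X * v * e * u)"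
    using assms by (intro f_swap closed_intros)
  also have "X * v * e * u = X * (v * u) * e"
    using assms(4) by (simp add: mult.assoc)
  also have "f \<dots> = f X"
    using assms by (simp add: f_right)
  finally show ?thesis .
qed

end

section \<open>Derivations under a corner functional\<close>

locale corner_derivation = corner_trace A C e f K + vn_derivation A C D
  for A :: "'a::chilbert_space cop set" and C e f K D
begin

text \<open>The logarithmic derivative of \<open>u ^ Suc n\<close> is that of \<open>u\<close> plus
  the conjugate by \<open>u\<close> of that of \<open>u ^ n\<close>, and \<open>f\<close> does not
  see the conjugation.\<close>

lemma f_logarithmic_derivative:
  assumes u: "u \<in> A" "v \<in> A" "u * v = 1" "v * u = 1" and eu: "e * u = u * e"
  shows "f (D (u ^ n) * v ^ n) = of_nat n * f (D u * v)"
proof (induction n)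
  case 0
  then show ?case
    by (simp add: D_one f_zero)
next
  case (Suc n)
  have uv: "u ^ n * v ^ n = 1" for n
  proof (induction n)
    case (Suc n)
    have "u ^ Suc n * v ^ Suc n = u * (u ^ n * v ^ n) * v"
      by (simp add: mult.assoc power_commutes)
    then show ?case
      by (simp add: Suc u)
  qed simp
  have "D (u ^ Suc n) * v ^ Suc n = (D u * u ^ n + u * D (u ^ n)) * (v ^ n * v)"
    using u by (simp add: D_mult closed_intros power_commutes)
  also have "\<dots> = D u * (u ^ n * v ^ n) * v + u * (D (u ^ n) * v ^ n) * v"
    by (simp add: distrib_right mult.assoc)
  finally have "f (D (u ^ Suc n) * v ^ Suc n) = f (D u * v + u * (D (u ^ n) * v ^ n) * v)"
    by (simp add: uv)
  also have "\<dots> = f (D u * v) + f (u * (D (u ^ n) * v ^ n) * v)"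
    using u by (intro f_add closed_intros D_closed)
  also have "f (u * (D (u ^ n) * v ^ n) * v) = f (D (u ^ n) * v ^ n)"
    using u eu by (intro f_conj closed_intros D_closed)
  finally show ?case
    using Suc by (simp add: algebra_simps)
qed

lemma norm_unitary_power_le:
  assumes "star u * u = 1" shows "norm (u ^ n) \<le> 1"
proof (induction n)
  case 0
  show ?case
    by (simp add: norm_one_cop_le)
next
  case (Suc n)
  have "norm u \<le> 1"
  proof (rule norm_cop_bound)
    fix x
    have "(norm (u \<cdot> x))\<^sup>2 = (norm x)\<^sup>2"
      using norm_ap_sq[of u x] assms by (simp add: cinner_self)
    then show "norm (u \<cdot> x) \<le> 1 * norm x"
      by simp
  qed simp
  then show ?case
    using Suc norm_mult_ineq[of u "u ^ n"] mult_mono[of "norm u" 1 "norm (u ^ n)" 1] by simp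
qed

text \<open>The numbers \<open>f (D (u ^ n) * u ^ (- n)) = n f (D u * u ^ (- 1))\<close> are bounded in \<open>n\<close>.\<close>

lemma f_unitary:
  assumes u: "u \<in> A" "star u * u = 1" "u * star u = 1" and eu: "e * u = u * e"
  shows "f (D u * star u) = 0"
proof -
  obtain M where M: "M \<ge> 0" "\<And>x. x \<in> A \<Longrightarrow> norm (D x) \<le> M * norm x"
    using bounded by blast
  have "real n * cmod (f (D u * star u)) \<le> K * M" for n
  proof -
    have "of_nat n * f (D u * star u) = f (D (u ^ n) * star u ^ n)"
      using f_logarithmic_derivative[of u "star u" n] u eu by (simp add: closed_intros)
    then have "real n * cmod (f (D u * star u)) = cmod (f (D (u ^ n) * star u ^ n))"
      by (metis norm_mult norm_of_nat)
    also have "\<dots> \<le> K * norm (D (u ^ n) * star u ^ n)"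
      using u by (intro f_bound closed_intros D_closed)
    also have "norm (D (u ^ n) * star u ^ n) \<le> norm (D (u ^ n)) * norm (star u ^ n)"
      by (rule norm_mult_ineq)
    also have "\<dots> \<le> M * 1"
    proof (rule mult_mono)
      show "norm (D (u ^ n)) \<le> M"
        using M(2)[of "u ^ n"] mult_left_mono[OF norm_unitary_power_le[OF u(2), of n] M(1)] u(1)
        by (simp add: closed_intros)
      show "norm (star u ^ n) \<le> 1"
        using norm_unitary_power_le[of "star u"] u by simp
    qed (use M in auto)
    finally show ?thesis
      using K by (simp add: mult_left_mono)
  qed
  then have "cmod (f (D u * star u)) = 0"
    by (intro eq_0_if_mult_bounded) auto
  then show ?thesis
    by simp
qed

text \<open>With \<open>s\<close> the square root in the unitary \<open>u\<close>, the element
  \<open>1 - s\<close> is of second order in \<open>r\<close>. As \<open>D\<close> is bounded and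
  kills \<open>1\<close>, so is \<open>D s\<close>, while \<open>star u\<close> tends to
  \<open>- \<i>\<close>. Thus \<open>f (D u * star u) = 0\<close> says that
  \<open>r * f (D h)\<close> is of second order; divide by \<open>r\<close>.\<close>

lemma f_derivation_selfadj:
  assumes h: "h \<in> A" "selfadj h" and eh: "e * h = h" "h * e = h"
  shows "f (D h) = 0"
proof -
  obtain M where M: "M \<ge> 0" "\<And>x. x \<in> A \<Longrightarrow> norm (D x) \<le> M * norm x"
    using bounded by blast
  define N where "N = norm h"
  \<comment> \<open>For \<open>r \<le> r0\<close> both \<open>r * N \<le> 1\<close>, which the
    square root demands, and \<open>r \<le> 1\<close>, which absorbs second powers of
    \<open>r\<close>.\<close>
  define r0 where "r0 = 1 / (N + 1)"
  have N: "N \<ge> 0" and r0: "r0 > 0" "r0 * N \<le> 1" "r0 \<le> 1"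
    by (simp_all add: N_def r0_def add_nonneg_pos divide_simps)
  \<comment> \<open>After division by \<open>r\<close>, the first summand bounds
    \<open>f (D h * star u)\<close> and the second \<open>f (D h * w)\<close> for the small element
    \<open>w\<close> introduced below.\<close>
  define Q where "Q = K * M * N\<^sup>2 + K * (M * N * (N + N\<^sup>2))"
  have est: "cmod (f (D h)) \<le> r * Q" if r: "0 < r" "r \<le> r0" for r
  proof -
    have rN: "r * N \<le> 1" "r \<le> 1"
      using r r0 N mult_right_mono[of r r0 N] by linarith+
    define B where "B = (r\<^sup>2) *\<^sub>R (h * h)"
    have B: "B \<in> A" "selfadj B"
      using h by (simp_all add: B_def closed_intros)
    have nB: "norm B \<le> r\<^sup>2 * N\<^sup>2"
      using norm_mult_ineq[of h h] by (simp add: B_def N_def power2_eq_square mult_left_mono)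
    also have "\<dots> = (r * N)\<^sup>2"
      by (simp add: power_mult_distrib)
    also have "\<dots> \<le> 1"
      using rN N r by (intro power_le_one) auto
    finally have "norm B \<le> 1" .
    then obtain s where s: "s \<in> A" "pos s" "s * s = 1 - B" "norm (1 - s) \<le> norm B"
        and sc: "\<And>T. T * B = B * T \<Longrightarrow> T * s = s * T"
      using sqrt_near_one[OF B] by metis
    have ss: "selfadj s"
      using s(2) by (rule pos_imp_selfadj)
    have hs: "h * s = s * h"
      by (rule sc) (simp add: B_def mult.assoc)
    have es: "e * s = s * e"
    proof (rule sc)
      have "e * (h * h) = h * h * e"
        using eh by (metis mult.assoc)
      then show "e * B = B * e"
        by (simp add: B_def)
    qed
    define u where "u = r *\<^sub>R h + cc \<i> * s"
    have uA: "u \<in> A"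
      using h s by (simp add: u_def closed_intros)
    have J: "cc \<i> * s = s * cc \<i>" "cc \<i> * h = h * cc \<i>" "cc \<i> * (cc \<i> * x) = - x" for x :: "'a cop"
      by (rule cc_commute[symmetric] cc_ii_twice)+
    have su: "star u = r *\<^sub>R h - cc \<i> * s"
      using h ss by (simp add: u_def cc_minus J)
    define t where "t = cc \<i> * s"
    have tt: "t * t = - (s * s)"
      unfolding t_def by (metis J(1,3) mult.assoc)
    have ht: "h * t = t * h"
      unfolding t_def by (metis J(2) hs mult.assoc)
    have "r *\<^sub>R h * r *\<^sub>R h = B"
      by (simp add: B_def power2_eq_square)
    moreover have "(r *\<^sub>R h - t) * (r *\<^sub>R h + t) = r *\<^sub>R h * r *\<^sub>R h - t * t"
      "(r *\<^sub>R h + t) * (r *\<^sub>R h - t) = r *\<^sub>R h * r *\<^sub>R h - t * t"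
      by (simp_all add: distrib_left distrib_right left_diff_distrib right_diff_distrib ht
          scaleR_diff_right scaleR_add_right)
    ultimately have uu: "star u * u = 1" "u * star u = 1"
      unfolding su unfolding u_def t_def[symmetric] by (simp_all add: tt s(3))
    have eu: "e * u = u * e"
    proof -
      have "e * (cc \<i> * s) = cc \<i> * s * e"
        by (metis cc_commute es mult.assoc)
      then show ?thesis
        by (simp add: u_def distrib_left distrib_right eh)
    qed
    have Ds: "D s = - D (1 - s)"
      using s by (simp add: D_diff D_one closed_intros)
    have "D u = r *\<^sub>R D h + cc \<i> * D s"
      using h s by (simp add: u_def D_add D_scaleR D_cc closed_intros)
    then have "0 = f (r *\<^sub>R (D h * star u) + cc \<i> * (D s * star u))"
      using f_unitary[OF uA uu eu] by (simp add: distrib_right mult.assoc)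
    also have "\<dots> = of_real r * f (D h * star u) + \<i> * f (D s * star u)"
      using h s uA by (simp add: f_add f_scaleR f_cc closed_intros D_closed)
    finally have "of_real r * f (D h * star u) = - (\<i> * f (D s * star u))"
      by (simp add: eq_neg_iff_add_eq_0)
    then have "r * cmod (f (D h * star u)) = cmod (f (D s * star u))"
      using r by (metis norm_ii norm_minus_cancel norm_mult norm_of_real abs_of_pos mult_1)
    also have "\<dots> \<le> K * norm (D s * star u)"
      using s uA by (intro f_bound closed_intros D_closed)
    also have "norm (D s * star u) \<le> (M * norm (1 - s)) * 1"
    proof (rule order_trans[OF norm_mult_ineq], rule mult_mono)
      show "norm (D s) \<le> M * norm (1 - s)"
        unfolding Ds using M(2)[of "1 - s"] s by (simp add: closed_intros)
      show "norm (star u) \<le> 1"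
        using norm_unitary_power_le[OF uu(1), of 1] by simp
    qed (use M in auto)
    also have "M * norm (1 - s) * 1 \<le> M * (r\<^sup>2 * N\<^sup>2)"
      using s(4) nB M by (simp add: mult_left_mono)
    finally have "r * cmod (f (D h * star u)) \<le> K * (M * (r\<^sup>2 * N\<^sup>2))"
      using K by (simp add: mult_left_mono)
    also have "\<dots> = r * (r * (K * M * N\<^sup>2))"
      by (simp add: power2_eq_square)
    finally have "r * cmod (f (D h * star u)) \<le> r * (r * (K * M * N\<^sup>2))" .
    then have 1: "cmod (f (D h * star u)) \<le> r * (K * M * N\<^sup>2)"
      using r by simp
    \<comment> \<open>This is \<open>star u + cc \<i>\<close>, the distance of \<open>star u\<close>
      from its limit; it is of first order in \<open>r\<close>.\<close>
    define w where "w = r *\<^sub>R h + cc \<i> * (1 - s)"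
    have wA: "w \<in> A"
      using h s by (simp add: w_def closed_intros)
    have "star u = w - cc \<i>"
      by (simp add: su w_def right_diff_distrib)
    then have "f (D h * star u) = f (D h * w) - \<i> * f (D h)"
      using h wA by (simp add: right_diff_distrib cc_commute f_diff f_cc closed_intros D_closed)
    then have "cmod (f (D h)) = cmod (f (D h * w) - f (D h * star u))"
      by (simp add: norm_mult)
    also have "\<dots> \<le> cmod (f (D h * w)) + cmod (f (D h * star u))"
      by (rule norm_triangle_ineq4)
    also have "cmod (f (D h * w)) \<le> K * norm (D h * w)"
      using h wA by (intro f_bound closed_intros D_closed)
    also have "norm (D h * w) \<le> (M * N) * (r * (N + N\<^sup>2))"
    proof (rule order_trans[OF norm_mult_ineq], rule mult_mono)
      show "norm (D h) \<le> M * N"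
        using M(2) h by (simp add: N_def)
      have "norm w \<le> r * N + norm (1 - s)"
        using norm_triangle_ineq[of "r *\<^sub>R h" "cc \<i> * (1 - s)"] norm_cc_mult_le[of \<i> "1 - s"] r
        by (simp add: w_def N_def)
      also have "norm (1 - s) \<le> r * N\<^sup>2"
      proof -
        have "r\<^sup>2 * N\<^sup>2 \<le> r * N\<^sup>2"
          using rN r by (intro mult_right_mono) (simp_all add: power2_eq_square mult_left_le)
        then show ?thesis
          using s(4) nB by linarith
      qed
      finally show "norm w \<le> r * (N + N\<^sup>2)"
        by (simp add: algebra_simps)
    qed (use M N in auto)
    finally have "cmod (f (D h)) \<le> K * (M * N * (r * (N + N\<^sup>2))) + r * (K * M * N\<^sup>2)"
      using 1 K by (simp add: mult_left_mono)
    then show ?thesis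
      by (simp add: Q_def algebra_simps)
  qed
  have "cmod (f (D h)) \<le> 0"
  proof (rule tendsto_lowerbound)
    show "((\<lambda>r. r * Q) \<longlongrightarrow> 0) (at_right 0)"
      by (auto intro!: tendsto_eq_intros)
    show "\<forall>\<^sub>F r in at_right 0. cmod (f (D h)) \<le> r * Q"
      unfolding eventually_at_right_field using est r0 by (intro exI[of _ r0]) auto
  qed simp
  then show ?thesis
    by simp
qed

lemma f_derivation_corner:
  assumes z: "z \<in> A" and ez: "e * z = z" "z * e = z"
  shows "f (D z) = 0"
proof -
  have sz: "e * star z = star z" "star z * e = star z"
    using arg_cong[OF ez(2), of star] arg_cong[OF ez(1), of star] e by simp_all
  have re: "reT z \<in> A" "e * reT z = reT z" "reT z * e = reT z"
    using z by (simp_all add: reT_def closed_intros distrib_left distrib_right ez sz)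
  have "e * (cc c * x) = cc c * (e * x)" for c x
    by (metis cc_commute mult.assoc)
  then have im: "imT z \<in> A" "e * imT z = imT z" "imT z * e = imT z"
    using z by (simp_all add: imT_def reT_def closed_intros distrib_left distrib_right ez sz
        mult.assoc cc_commute[of "star z"])
  have "D z = D (reT z) + cc \<i> * D (imT z)"
    using D_add[of "reT z" "cc \<i> * imT z"] D_cc[of "imT z" \<i>] re_im_decomp[of z] re im
    by (simp add: closed_intros)
  then have "f (D z) = f (D (reT z)) + \<i> * f (D (imT z))"
    using re im by (simp add: f_add f_cc closed_intros D_closed)
  then show ?thesis
    using f_derivation_selfadj[OF re(1) selfadj_reT re(2,3)]
      f_derivation_selfadj[OF im(1) selfadj_imT im(2,3)] by simp
qed

text \<open>The right-hand side involves \<open>D\<close> only through \<open>D w\<close> and is linear in \<open>x\<close>.\<close>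

theorem f_derivation_by_parts:
  assumes x: "x \<in> A" and w: "w \<in> A" and ew: "e * w = w" "w * e = w"
  shows "f (D x * w) = - (f (x * D w) + f (D w * (1 - e) * x))"
proof -
  note cl = closed_intros D_closed x w e(1)
  have De: "e * (D e * e) = 0"
  proof -
    have "D e = D e * e + e * D e"
      using D_mult[OF e(1) e(1)] e(3) by simp
    then have "e * D e * e = e * (D e * e + e * D e) * e"
      by simp
    also have "\<dots> = e * D e * e + e * D e * e"
      using e(3) by (simp add: distrib_left distrib_right mult.assoc)
    finally show ?thesis
      by (simp add: mult.assoc)
  qed
  \<comment> \<open>\<open>y\<close> is the part of \<open>x * w\<close> inside the corner, where
    \<open>f_derivation_corner\<close> applies. The remainder carries a factor \<open>1 - e\<close>;
    differentiating it gives a term killed by \<open>f\<close> and a term in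
    \<open>D e\<close>.\<close>
  define y where "y = e * x * w"
  have yA: "y \<in> A"
    unfolding y_def by (intro cl)
  have "e * y = y" "y * e = y"
    using ew by (simp_all add: y_def mult.assoc)
  then have fy: "f (D y) = 0"
    using yA by (intro f_derivation_corner)
  have "x * w = y + (1 - e) * (x * w)"
    by (simp add: y_def left_diff_distrib mult.assoc)
  then have "D (x * w) = D y + D ((1 - e) * (x * w))"
    using yA D_add[of y "(1 - e) * (x * w)"] by (simp add: cl)
  also have "D ((1 - e) * (x * w)) = (1 - e) * D (x * w) - D e * (x * w)"
    using D_mult[of "1 - e" "x * w"] by (simp add: D_diff D_one cl)
  finally have "f (D (x * w)) = f (D y + ((1 - e) * D (x * w) - D e * (x * w)))"
    by (rule arg_cong)
  also have "\<dots> = f (D y) + (f ((1 - e) * D (x * w)) - f (D e * (x * w)))"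
    using yA by (simp add: f_add f_diff cl)
  finally have 1: "f (D (x * w)) = - f (D e * (x * w))"
    using fy f_left_kill[of "D (x * w)"] by (simp add: cl)
  \<comment> \<open>The term in \<open>D e\<close> has to be expressed by \<open>D w\<close>.
    Differentiating \<open>w = w * e\<close> and multiplying by \<open>1 - e\<close> isolates
    \<open>w * D e * (1 - e)\<close>; then \<open>w\<close> is swapped around to the right
    end.\<close>
  have "D w = D w * e + w * D e"
    using D_mult[OF w e(1)] ew by simp
  then have "D w * (1 - e) = (D w * e + w * D e) * (1 - e)"
    by simp
  also have "\<dots> = w * D e * (1 - e)"
    by (simp add: distrib_right right_diff_distrib mult.assoc e(3))
  also have "\<dots> = w * e * (D e * (1 - e))"
    using ew by (simp add: mult.assoc)
  finally have "f (D w * (1 - e) * x) = f (w * e * (D e * (1 - e) * x))"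
    by (simp add: mult.assoc)
  also have "\<dots> = f (D e * (1 - e) * x * e * w)"
    by (intro f_swap cl)
  also have "D e * (1 - e) * x * e * w = D e * (x * w) - D e * e * (x * w)"
    using ew by (simp add: left_diff_distrib right_diff_distrib mult.assoc)
  also have "f \<dots> = f (D e * (x * w)) - f (D e * e * (x * w))"
    by (intro f_diff cl)
  also have "f (D e * e * (x * w)) = f (e * (D e * e * (x * w)))"
    by (simp add: f_left cl)
  also have "e * (D e * e * (x * w)) = 0"
    using De by (metis mult.assoc mult_zero_left)
  finally have 2: "f (D w * (1 - e) * x) = f (D e * (x * w))"
    by (simp add: f_zero)
  have "f (D (x * w)) = f (D x * w) + f (x * D w)"
    unfolding D_mult[OF x w] by (intro f_add cl)
  then show ?thesis
    using 1 2 by (simp add: eq_neg_iff_add_eq_0 algebra_simps)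
qed

end


section \<open>Semi-finite traces\<close>

lemma re_im_cc_mult:
  fixes x :: "'a::chilbert_space cop"
  shows "reT (cc c * x) = Re c *\<^sub>R reT x - Im c *\<^sub>R imT x"
  "imT (cc c * x) = Re c *\<^sub>R imT x + Im c *\<^sub>R reT x"
proof -
  have "(cc c :: 'a cop) = Re c *\<^sub>R 1 + Im c *\<^sub>R cc \<i>"
  proof -
    have "(cc c :: 'a cop) = cc (of_real (Re c) + of_real (Im c) * \<i>)"
      by (metis complex_eq mult.commute)
    then show ?thesis
      by (simp add: cc_simps(1,2,5))
  qed
  then have c: "cc c * x = Re c *\<^sub>R x + Im c *\<^sub>R (cc \<i> * x)" for x :: "'a cop"
    by (simp add: distrib_right)
  show "reT (cc c * x) = Re c *\<^sub>R reT x - Im c *\<^sub>R imT x"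
    using reT_scaleR[of "-1" "cc \<i> * x"] unfolding c
    by (simp add: reT_add reT_scaleR imT_def cc_minus)
  have "cc (- \<i>) * (cc c * x) = Re c *\<^sub>R (cc (- \<i>) * x) + Im c *\<^sub>R x"
    unfolding c by (simp add: distrib_left cc_minus cc_ii_twice)
  then show "imT (cc c * x) = Re c *\<^sub>R imT x + Im c *\<^sub>R reT x"
    unfolding imT_def by (simp add: reT_add reT_scaleR)
qed

lemma imT_selfadj: "selfadj T \<Longrightarrow> imT T = 0"
  by (simp add: imT_def reT_def cc_minus cc_commute)

lemma reT_selfadj: "selfadj T \<Longrightarrow> reT T = T"
  by (simp add: reT_def flip: scaleR_2)

locale vn_trace = vn_algebra A C for A :: "'a::chilbert_space cop set" and C +
  fixes \<tau> :: "'a cop \<Rightarrow> ennreal"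
  assumes tr_add: "S \<in> A \<Longrightarrow> T \<in> A \<Longrightarrow> pos S \<Longrightarrow> pos T \<Longrightarrow> \<tau> (S + T) = \<tau> S + \<tau> T"
    and tr_scale: "T \<in> A \<Longrightarrow> pos T \<Longrightarrow> r \<ge> 0 \<Longrightarrow> \<tau> (r *\<^sub>R T) = ennreal r * \<tau> T"
    and tr_comm: "T \<in> A \<Longrightarrow> \<tau> (star T * T) = \<tau> (T * star T)"
    and tr_faithful: "T \<in> A \<Longrightarrow> pos T \<Longrightarrow> \<tau> T = 0 \<Longrightarrow> T = 0"
    and tr_semifinite: "T \<in> A \<Longrightarrow> pos T \<Longrightarrow> T \<noteq> 0 \<Longrightarrow>
      \<exists>S\<in>A. pos S \<and> S \<noteq> 0 \<and> pos (T - S) \<and> \<tau> S < \<infinity>"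
begin

lemma tr_mono:
  assumes "S \<in> A" "T \<in> A" "pos S" "pos (T - S)" shows "\<tau> S \<le> \<tau> T"
  using tr_add[of S "T - S"] assms by (simp add: closed_intros)

end

text \<open>The positive functional \<open>x \<mapsto> \<tau> (e x e)\<close> of a projection of finite trace, extended
  from the positive cone by \<open>h = (h + norm h) - norm h\<close>.\<close>

locale finite_projection = vn_trace A C \<tau> for A :: "'a::chilbert_space cop set" and C \<tau> +
  fixes e :: "'a cop"
  assumes e: "e \<in> A" "selfadj e" "e * e = e" and fin: "\<tau> e < \<infinity>"
begin

definition cone_trace :: "'a cop \<Rightarrow> real"
  where "cone_trace x = enn2real (\<tau> (e * x * e))"

definition selfadj_trace :: "'a cop \<Rightarrow> real"
  where "selfadj_trace h = cone_trace (h + norm h *\<^sub>R 1) - norm h * cone_trace 1"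

definition corner_functional :: "'a cop \<Rightarrow> complex"
  where "corner_functional x = Complex (selfadj_trace (reT x)) (selfadj_trace (imT x))"

lemma pos_corner: "pos x \<Longrightarrow> pos (e * x * e)"
  using pos_conj[of x e] e by simp

lemma ee: "e * (e * x) = e * x"
  by (simp add: e flip: mult.assoc)

text \<open>\<open>e x e\<close> is dominated by \<open>norm x\<close> times \<open>e\<close>. On
  the positive cone \<open>cone_trace\<close> therefore never meets the value infinity, which
  \<open>enn2real\<close> would send to 0.\<close>

lemma tr_corner_finite:
  assumes "x \<in> A" "pos x" shows "\<tau> (e * x * e) < top"
proof -
  have "pos (e * (norm x *\<^sub>R 1 - x) * e)"
    using assms pos_imp_selfadj by (intro pos_corner pos_norm_diff) auto
  then have "pos (norm x *\<^sub>R e - e * x * e)"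
    by (simp add: e left_diff_distrib right_diff_distrib)
  then have "\<tau> (e * x * e) \<le> \<tau> (norm x *\<^sub>R e)"
    using assms e by (intro tr_mono pos_corner) (simp_all add: closed_intros)
  also have "pos e"
    using pos_star_mult[of e] e by simp
  then have "\<tau> (norm x *\<^sub>R e) = ennreal (norm x) * \<tau> e"
    using e by (intro tr_scale) auto
  also have "\<dots> < top"
    using fin by (simp add: ennreal_mult_less_top)
  finally show ?thesis .
qed

lemma cone_trace_nonneg: "0 \<le> cone_trace x"
  by (simp add: cone_trace_def)

lemma cone_trace_add:
  assumes "x \<in> A" "y \<in> A" "pos x" "pos y" shows "cone_trace (x + y) = cone_trace x + cone_trace y"
proof -
  have "\<tau> (e * (x + y) * e) = \<tau> (e * x * e) + \<tau> (e * y * e)"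
    using tr_add[of "e * x * e" "e * y * e"] assms e
    by (simp add: closed_intros pos_corner distrib_left distrib_right)
  then show ?thesis
    using tr_corner_finite assms by (simp add: cone_trace_def enn2real_plus)
qed

lemma cone_trace_scaleR:
  assumes "x \<in> A" "pos x" "r \<ge> 0" shows "cone_trace (r *\<^sub>R x) = r * cone_trace x"
  using tr_scale[of "e * x * e" r] assms e by (simp add: cone_trace_def closed_intros pos_corner enn2real_mult)

lemma cone_trace_comm:
  assumes "x \<in> A" shows "cone_trace (star x * e * x) = cone_trace (x * e * star x)"
  using tr_comm[of "e * x * e"] assms e by (simp add: cone_trace_def closed_intros mult.assoc ee)

text \<open>Any shift \<open>c\<close> above \<open>norm h\<close> gives the same value. Additivity
  depends on this, since \<open>norm (h + k)\<close> may be smaller than the sum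
  \<open>norm h + norm k\<close> of the two shifts.\<close>

lemma selfadj_trace_eq:
  assumes h: "h \<in> A" "selfadj h" and c: "norm h \<le> c"
  shows "selfadj_trace h = cone_trace (h + c *\<^sub>R 1) - c * cone_trace 1"
proof -
  have ph: "pos (h + norm h *\<^sub>R 1)"
    using pos_norm_add[OF h(2), of "norm h"] by (simp add: add.commute)
  have "h + c *\<^sub>R 1 = (h + norm h *\<^sub>R 1) + (c - norm h) *\<^sub>R 1"
    by (simp add: algebra_simps)
  then have "cone_trace (h + c *\<^sub>R 1) = cone_trace ((h + norm h *\<^sub>R 1) + (c - norm h) *\<^sub>R 1)"
    by (rule arg_cong)
  also have "\<dots> = cone_trace (h + norm h *\<^sub>R 1) + cone_trace ((c - norm h) *\<^sub>R 1)"
    using cone_trace_add[OF _ _ ph, of "(c - norm h) *\<^sub>R 1"] h c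
    by (simp add: closed_intros pos_scaleR pos_one)
  finally show ?thesis
    using cone_trace_scaleR[of 1 "c - norm h"] c
    by (simp add: selfadj_trace_def closed_intros pos_one algebra_simps)
qed

lemma selfadj_trace_add:
  assumes h: "h \<in> A" "selfadj h" and k: "k \<in> A" "selfadj k"
  shows "selfadj_trace (h + k) = selfadj_trace h + selfadj_trace k"
proof -
  have "cone_trace ((h + norm h *\<^sub>R 1) + (k + norm k *\<^sub>R 1)) = cone_trace (h + norm h *\<^sub>R 1) + cone_trace (k + norm k *\<^sub>R 1)"
    using pos_norm_add[OF h(2), of "norm h"] pos_norm_add[OF k(2), of "norm k"] h k
    by (intro cone_trace_add) (simp_all add: closed_intros add.commute)
  also have "(h + norm h *\<^sub>R 1) + (k + norm k *\<^sub>R 1) = (h + k) + (norm h + norm k) *\<^sub>R 1"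
    by (simp add: algebra_simps)
  finally show ?thesis
    using selfadj_trace_eq[of "h + k" "norm h + norm k"] h k
    by (simp add: closed_intros norm_triangle_ineq selfadj_trace_def algebra_simps)
qed

lemma selfadj_trace_pos: "x \<in> A \<Longrightarrow> pos x \<Longrightarrow> selfadj_trace x = cone_trace x"
  using cone_trace_add[of x "norm x *\<^sub>R 1"] cone_trace_scaleR[of 1 "norm x"]
  by (simp add: selfadj_trace_def closed_intros pos_one pos_scaleR)

lemma selfadj_trace_zero: "selfadj_trace 0 = 0"
  using selfadj_trace_add[of 0 0] by (simp add: zero_closed)

lemma selfadj_trace_minus: "h \<in> A \<Longrightarrow> selfadj h \<Longrightarrow> selfadj_trace (- h) = - selfadj_trace h"
  using selfadj_trace_add[of h "- h"] by (simp add: selfadj_trace_zero closed_intros)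

lemma selfadj_trace_scaleR:
  assumes h: "h \<in> A" "selfadj h" shows "selfadj_trace (r *\<^sub>R h) = r * selfadj_trace h"
proof -
  have nn: "selfadj_trace (r *\<^sub>R h) = r * selfadj_trace h" if "r \<ge> 0" for r
  proof -
    have "selfadj_trace (r *\<^sub>R h) = cone_trace (r *\<^sub>R (h + norm h *\<^sub>R 1)) - r * norm h * cone_trace 1"
      using that by (simp add: selfadj_trace_def scaleR_add_right)
    also have "cone_trace (r *\<^sub>R (h + norm h *\<^sub>R 1)) = r * cone_trace (h + norm h *\<^sub>R 1)"
      using that h pos_norm_add[OF h(2), of "norm h"]
      by (intro cone_trace_scaleR) (simp_all add: closed_intros add.commute)
    finally show ?thesis
      by (simp add: selfadj_trace_def algebra_simps)
  qed
  show ?thesis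
  proof (cases "r \<ge> 0")
    case False
    then have "selfadj_trace (- (r *\<^sub>R h)) = - r * selfadj_trace h"
      using nn[of "- r"] by simp
    then show ?thesis
      using selfadj_trace_minus[of "r *\<^sub>R h"] h by (simp add: closed_intros)
  qed (use nn in simp)
qed

lemma selfadj_trace_bound:
  assumes h: "h \<in> A" "selfadj h" shows "\<bar>selfadj_trace h\<bar> \<le> norm h * cone_trace 1"
proof -
  have "- (norm h * cone_trace 1) \<le> selfadj_trace h" "- (norm h * cone_trace 1) \<le> selfadj_trace (- h)"
    using cone_trace_nonneg by (simp_all add: selfadj_trace_def)
  then show ?thesis
    using selfadj_trace_minus[OF h] by (simp add: abs_le_iff)
qed

lemma norm_corner_le: "norm (e * h * e) \<le> norm h"
proof -
  have "norm e \<le> 1"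
  proof (rule norm_cop_bound)
    fix x
    have "(norm (e \<cdot> x))\<^sup>2 = Re (cinner (e \<cdot> x) x)"
      using norm_ap_sq[of e x] e by simp
    also have "\<dots> \<le> norm (e \<cdot> x) * norm x"
      by (rule Re_cinner_le)
    finally show "norm (e \<cdot> x) \<le> 1 * norm x"
      by (cases "e \<cdot> x = 0") (auto simp: power2_eq_square)
  qed simp
  have "norm (e * h * e) \<le> norm e * norm h * norm e"
    by (meson mult_right_mono norm_ge_zero norm_mult_ineq order_trans)
  also have "\<dots> \<le> 1 * norm h * 1"
    using \<open>norm e \<le> 1\<close> by (intro mult_mono) auto
  finally show ?thesis
    by simp
qed

lemma selfadj_trace_corner:
  assumes h: "h \<in> A" "selfadj h" shows "selfadj_trace (e * h * e) = selfadj_trace h"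
proof -
  have "selfadj_trace (e * h * e) = cone_trace (e * h * e + norm h *\<^sub>R 1) - norm h * cone_trace 1"
    using h e by (intro selfadj_trace_eq norm_corner_le) (simp_all add: closed_intros mult.assoc)
  also have "cone_trace (e * h * e + norm h *\<^sub>R 1) = cone_trace (h + norm h *\<^sub>R 1)"
    by (simp add: cone_trace_def distrib_left distrib_right mult.assoc ee e)
  finally show ?thesis
    by (simp add: selfadj_trace_def)
qed

lemma part_closed: "x \<in> A \<Longrightarrow> reT x \<in> A" "x \<in> A \<Longrightarrow> imT x \<in> A"
  by (simp_all add: reT_def imT_def closed_intros)

lemma imT_add: "imT (x + y) = imT x + imT y"
  by (simp add: imT_def distrib_left reT_add)

lemma corner_functional_add: "x \<in> A \<Longrightarrow> y \<in> A \<Longrightarrow> corner_functional (x + y) = corner_functional x + corner_functional y"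
  by (simp add: corner_functional_def reT_add imT_add selfadj_trace_add part_closed selfadj_reT selfadj_imT complex_eq_iff)

lemma corner_functional_cc:
  assumes "x \<in> A" shows "corner_functional (cc c * x) = c * corner_functional x"
proof -
  have "selfadj_trace (r *\<^sub>R h + s *\<^sub>R k) = r * selfadj_trace h + s * selfadj_trace k" if "h \<in> A" "selfadj h" "k \<in> A" "selfadj k" for r s h k
    using that by (simp add: selfadj_trace_add selfadj_trace_scaleR closed_intros)
  from this[of "reT x" "imT x" "Re c" "- Im c"] this[of "imT x" "reT x" "Re c" "Im c"]
  show ?thesis
    using assms by (simp add: corner_functional_def re_im_cc_mult part_closed selfadj_reT selfadj_imT complex_eq_iff)
qed

lemma corner_functional_pos: "x \<in> A \<Longrightarrow> pos x \<Longrightarrow> corner_functional x = of_real (cone_trace x)"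
  by (simp add: corner_functional_def reT_selfadj imT_selfadj pos_imp_selfadj selfadj_trace_pos selfadj_trace_zero complex_eq_iff)

lemma corner_functional_swap_star:
  assumes "x \<in> A" shows "corner_functional (star x * e * x) = corner_functional (x * e * star x)"
proof -
  have pe: "pos e"
    using pos_star_mult[of e] e by simp
  have "pos (star x * e * x)" "pos (x * e * star x)"
    using pos_conj[OF pe, of x] pos_conj[OF pe, of "star x"] by simp_all
  then show ?thesis
    using assms e by (simp add: corner_functional_pos closed_intros cone_trace_comm)
qed

text \<open>Polarisation of the case \<open>y = star x\<close>. Expanding at \<open>a + b\<close>
  yields the sum of the wanted identity and its mirror image; taking \<open>b = \<i> y\<close>
  changes the sign of the terms with \<open>star y\<close> and yields their difference.\<close>

lemma corner_functional_swap:
  assumes "x \<in> A" "y \<in> A" shows "corner_functional (x * e * y) = corner_functional (y * e * x)"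
proof -
  define a where "a = star x"
  have aA: "a \<in> A" and x: "x = star a"
    using assms by (simp_all add: a_def closed_intros)
  note cl = closed_intros aA assms e(1)
  have pol: "corner_functional (star a * e * b) + corner_functional (star b * e * a) = corner_functional (a * e * star b) + corner_functional (b * e * star a)"
    if b: "b \<in> A" for b
  proof -
    have "corner_functional (star (a + b) * e * (a + b)) = corner_functional ((a + b) * e * star (a + b))"
      using b by (intro corner_functional_swap_star cl)
    moreover have "corner_functional (star (a + b) * e * (a + b))
      = corner_functional (star a * e * a) + corner_functional (star a * e * b) + (corner_functional (star b * e * a) + corner_functional (star b * e * b))"
      using b by (simp add: distrib_left distrib_right corner_functional_add cl)
    moreover have "corner_functional ((a + b) * e * star (a + b))
      = corner_functional (a * e * star a) + corner_functional (a * e * star b) + (corner_functional (b * e * star a) + corner_functional (b * e * star b))"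
      using b by (simp add: distrib_left distrib_right corner_functional_add cl)
    ultimately show ?thesis
      using corner_functional_swap_star[OF aA] corner_functional_swap_star[OF b] by simp
  qed
  have mv: "p * e * (cc c * z) = cc c * (p * e * z)" "cc c * z * e * p = cc c * (z * e * p)" for p z c
    by (metis cc_commute mult.assoc) (simp add: mult.assoc)
  have "corner_functional (cc \<i> * (star a * e * y)) + corner_functional (cc (- \<i>) * (star y * e * a))
      = corner_functional (cc (- \<i>) * (a * e * star y)) + corner_functional (cc \<i> * (y * e * star a))"
    using pol[of "cc \<i> * y"] assms by (simp add: cl cc_commute[of "star y"] mv)
  then have "\<i> * (corner_functional (star a * e * y) - corner_functional (star y * e * a))
      = \<i> * (corner_functional (y * e * star a) - corner_functional (a * e * star y))"
    using assms by (simp add: corner_functional_cc cl algebra_simps)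
  then have "corner_functional (star a * e * y) - corner_functional (star y * e * a) = corner_functional (y * e * star a) - corner_functional (a * e * star y)"
    by simp
  then have "corner_functional (star a * e * y) = corner_functional (y * e * star a)"
    using pol[OF assms(2)] by algebra
  then show ?thesis
    by (simp add: x)
qed

text \<open>The bound estimates real and imaginary part separately, hence the factor 2. Faithfulness
  holds because \<open>e * (x * e * star x) * e\<close> is the product of \<open>e * x * e\<close>
  and its adjoint.\<close>

sublocale corner_trace A C e corner_functional "2 * cone_trace 1"
proof
  fix x y assume x: "x \<in> A"
  show "cmod (corner_functional x) \<le> 2 * cone_trace 1 * norm x"
  proof -
    have "cmod (corner_functional x) \<le> \<bar>selfadj_trace (reT x)\<bar> + \<bar>selfadj_trace (imT x)\<bar>"
      using cmod_le[of "corner_functional x"] by (simp add: corner_functional_def)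
    also have "\<dots> \<le> norm (reT x) * cone_trace 1 + norm (imT x) * cone_trace 1"
      using x by (intro add_mono selfadj_trace_bound part_closed selfadj_reT selfadj_imT)
    also have "\<dots> \<le> norm x * cone_trace 1 + norm x * cone_trace 1"
      by (intro add_mono mult_right_mono norm_reT_le norm_imT_le cone_trace_nonneg)
    finally show ?thesis
      by (simp add: mult.assoc mult.commute[of "cone_trace 1"])
  qed
  have "reT (e * x * e) = e * reT x * e"
    by (simp add: reT_def e distrib_left distrib_right mult.assoc)
  moreover have "T * (cc c * z) = cc c * (T * z)" for c and T z :: "'a cop"
    by (metis cc_commute mult.assoc)
  then have "imT (e * x * e) = e * imT x * e"
    by (simp add: imT_def reT_def e distrib_left distrib_right mult.assoc
        cc_commute[of "star x"] cc_commute[of e])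
  ultimately show "corner_functional (e * x * e) = corner_functional x"
    using x by (simp add: corner_functional_def selfadj_trace_corner part_closed selfadj_reT selfadj_imT)
  assume 0: "corner_functional (x * e * star x) = 0"
  show "e * x * e = 0"
  proof -
    have "pos e"
      using pos_star_mult[of e] e by simp
    from pos_conj[OF this, of "star x"] have p: "pos (x * e * star x)"
      by simp
    then have "cone_trace (x * e * star x) = 0"
      using 0 x e by (simp add: corner_functional_pos closed_intros)
    moreover have "\<tau> (e * (x * e * star x) * e) < top"
      using x e p by (intro tr_corner_finite closed_intros)
    ultimately have "\<tau> (e * (x * e * star x) * e) = 0"
      by (auto simp: cone_trace_def enn2real_eq_0_iff)
    then have "e * (x * e * star x) * e = 0"
      using x e p by (intro tr_faithful closed_intros pos_corner)
    then have "star (star (e * x * e)) * star (e * x * e) = 0"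
      by (simp add: e mult.assoc ee)
    then show ?thesis
      by (simp only: star_mult_self_eq_0 star_eq_0)
  qed
qed (simp_all add: e corner_functional_add corner_functional_cc corner_functional_swap cone_trace_nonneg)

end

section \<open>Finite projections separate the elements of the algebra\<close>

context vn_trace
begin

text \<open>Semi-finiteness supplies a nonzero \<open>S\<close> of finite trace below
  \<open>T\<close>. A projection with \<open>c e \<le> S\<close> then has finite trace by
  monotonicity.\<close>

lemma finite_projection_below:
  assumes T: "T \<in> A" "pos T" "T \<noteq> 0"
  obtains e c where "finite_projection A C \<tau> e" "e \<noteq> 0" "c > 0" "pos (T - c *\<^sub>R e)"
proof -
  obtain S where S: "S \<in> A" "pos S" "S \<noteq> 0" "pos (T - S)" "\<tau> S < \<infinity>"
    using tr_semifinite[OF T] by blast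
  obtain e c where e: "e \<in> A" "selfadj e" "e * e = e" "e \<noteq> 0" and c: "c > 0" "pos (S - c *\<^sub>R e)"
    using dominated_projection[OF S(1-3)] by blast
  have pe: "pos e"
    using pos_star_mult[of e] e by simp
  have "\<tau> (c *\<^sub>R e) \<le> \<tau> S"
    using e c pe S by (intro tr_mono) (auto intro: closed_intros pos_scaleR)
  then have "ennreal c * \<tau> e < \<infinity>"
    using S(5) tr_scale[OF e(1) pe, of c] c by simp
  then have "\<tau> e < \<infinity>"
    using c by (auto simp: ennreal_mult_less_top)
  then have "finite_projection A C \<tau> e"
    using e by unfold_locales
  moreover have "pos (T - c *\<^sub>R e)"
    using pos_add[OF S(4) c(2)] by simp
  ultimately show ?thesis
    using that e(4) c(1) by blast
qed

text \<open>If \<open>p\<close> were nonzero, some finite projection would satisfy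
  \<open>c e \<le> p\<close>. It vanishes on the range of \<open>n\<close>, because \<open>p\<close>
  does, so the corner of \<open>p - n\<close> equals that of \<open>p\<close>. This corner is zero
  but dominates \<open>c e\<close>, a contradiction.\<close>

lemma positive_part_zero:
  assumes pn: "p \<in> A" "pos p" "pos n" "p * n = 0"
    and corner: "\<And>e. finite_projection A C \<tau> e \<Longrightarrow> e * (p - n) * e = 0"
  shows "p = 0"
proof (rule ccontr)
  assume "p \<noteq> 0"
  then obtain e c where fin: "finite_projection A C \<tau> e" and e0: "e \<noteq> 0"
      and c: "c > 0" "pos (p - c *\<^sub>R e)"
    using finite_projection_below[OF pn(1,2)] by blast
  note e = finite_projection.e[OF fin]
  have "e * n = 0"
  proof (rule cop_eqI)
    fix z
    have "p \<cdot> n \<cdot> z = 0"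
      using pn(4) by (metis ap_simps(1,6))
    then have "0 \<le> - (c * Re (cinner (e \<cdot> n \<cdot> z) (n \<cdot> z)))"
      using posD[OF c(2), of "n \<cdot> z"] by (simp add: cinner_simps)
    also have "Re (cinner (e \<cdot> n \<cdot> z) (n \<cdot> z)) = (norm (e \<cdot> n \<cdot> z))\<^sup>2"
      using norm_ap_sq[of e "n \<cdot> z"] e by simp
    finally have "(norm (e \<cdot> n \<cdot> z))\<^sup>2 \<le> 0"
      using c(1) by (simp add: mult_le_0_iff)
    then show "(e * n) \<cdot> z = 0 \<cdot> z"
      by simp
  qed
  then have "e * p * e = 0"
    using corner[OF fin] by (simp add: right_diff_distrib)
  then have "pos (- (c *\<^sub>R e))"
    using pos_conj[OF c(2), of e] e by (simp add: right_diff_distrib left_diff_distrib)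
  moreover have "pos (c *\<^sub>R e)"
    using pos_scaleR[of c "star e * e"] pos_star_mult[of e] c(1) e by simp
  ultimately show False
    using pos_antisym[of "c *\<^sub>R e"] c(1) e0 by simp
qed

text \<open>Corner functionals only give information about \<open>e * d * e\<close>; this lemma
  passes from there to \<open>d\<close>. For self-adjoint elements the positive and the negative
  part are removed one after the other, and the general case splits into real and imaginary
  part.\<close>

lemma zero_if_corners_zero:
  assumes d: "d \<in> A" and corner: "\<And>e. finite_projection A C \<tau> e \<Longrightarrow> e * d * e = 0"
  shows "d = 0"
proof -
  have sa: "h = 0" if h: "h \<in> A" "selfadj h"
    and corner: "\<And>e. finite_projection A C \<tau> e \<Longrightarrow> e * h * e = 0" for h
  proof -
    obtain p n where pn: "p \<in> A" "n \<in> A" "pos p" "pos n" "h = p - n" "p * n = 0" "n * p = 0"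
      using pos_neg_parts[OF h] by metis
    have "p = 0"
      using corner pn by (intro positive_part_zero[of p n]) auto
    moreover have "n = 0"
    proof (rule positive_part_zero[of n p])
      show "e * (n - p) * e = 0" if "finite_projection A C \<tau> e" for e
        using corner[OF that] pn(5) by (simp add: right_diff_distrib left_diff_distrib)
    qed (use pn in auto)
    ultimately show ?thesis
      using pn by simp
  qed
  have star_corner: "e * star d * e = 0" if "finite_projection A C \<tau> e" for e
    using arg_cong[OF corner[OF that], of star] finite_projection.e[OF that] by (simp add: mult.assoc)
  have "reT d = 0"
  proof (rule sa[OF _ selfadj_reT])
    show "e * reT d * e = 0" if "finite_projection A C \<tau> e" for e
      using corner[OF that] star_corner[OF that] by (simp add: reT_def distrib_left distrib_right)
  qed (use d in \<open>simp add: reT_def closed_intros\<close>)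
  moreover have "imT d = 0"
  proof (rule sa[OF _ selfadj_imT])
    fix e assume "finite_projection A C \<tau> e"
    then have "e * d * e = 0" "e * star d * e = 0"
      using corner star_corner by auto
    moreover have "e * (cc c * x) * e = cc c * (e * x * e)" for c x
      by (metis cc_commute mult.assoc)
    ultimately show "e * imT d * e = 0"
      by (simp add: imT_def reT_def distrib_left distrib_right cc_commute[of "star d"])
  qed (use d in \<open>simp add: imT_def reT_def closed_intros\<close>)
  ultimately show ?thesis
    by (metis re_im_decomp add_0 mult_zero_right)
qed

end

section \<open>2-local derivations\<close>

locale two_local_derivation = vn_trace A C \<tau> for A :: "'a::chilbert_space cop set" and C \<tau> +
  fixes \<Delta> :: "'a cop \<Rightarrow> 'a cop"
  assumes two_local: "x \<in> A \<Longrightarrow> y \<in> A \<Longrightarrow> \<exists>D. vn_derivation A C D \<and> \<Delta> x = D x \<and> \<Delta> y = D y"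
begin

lemma map_closed: "x \<in> A \<Longrightarrow> \<Delta> x \<in> A"
  by (metis two_local vn_derivation.D_closed)

lemma by_parts:
  assumes fin: "finite_projection A C \<tau> e" and x: "x \<in> A"
    and w: "w \<in> A" and ew: "e * w = w" "w * e = w"
  shows "finite_projection.corner_functional \<tau> e (\<Delta> x * w) =
    - (finite_projection.corner_functional \<tau> e (x * \<Delta> w) + finite_projection.corner_functional \<tau> e (\<Delta> w * (1 - e) * x))"
proof -
  interpret finite_projection A C \<tau> e
    by (rule fin)
  obtain D where D: "vn_derivation A C D" "\<Delta> x = D x" "\<Delta> w = D w"
    using two_local[OF x w] by blast
  interpret vn_derivation A C D
    by (rule D(1))
  interpret corner_derivation A C e corner_functional "2 * cone_trace 1" D
    by unfold_locales
  show ?thesis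
    unfolding D(2,3) using x w ew by (rule f_derivation_by_parts)
qed

lemma additive:
  assumes x: "x \<in> A" and y: "y \<in> A"
  shows "\<Delta> (x + y) = \<Delta> x + \<Delta> y"
proof -
  define d where "d = \<Delta> (x + y) - \<Delta> x - \<Delta> y"
  have dA: "d \<in> A"
    unfolding d_def using x y by (intro closed_intros map_closed)
  have "d = 0"
  proof (rule zero_if_corners_zero[OF dA])
    fix e assume fp: "finite_projection A C \<tau> e"
    interpret finite_projection A C \<tau> e
      by (rule fp)
    note cl = closed_intros map_closed x y dA e(1)
    \<comment> \<open>With this test element \<open>f (d * w) = f (d * e * star d)\<close>, to which
      faithfulness applies. The same \<open>w\<close> serves \<open>x + y\<close>, \<open>x\<close>
      and \<open>y\<close>, so the three formulas share \<open>\<Delta> w\<close> although each uses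
      its own derivation.\<close>
    define w where "w = e * star d * e"
    have w: "w \<in> A" "e * w = w" "w * e = w"
      using dA e by (simp_all add: w_def closed_intros mult.assoc)
    have "corner_functional (d * w) = corner_functional (\<Delta> (x + y) * w) - corner_functional (\<Delta> x * w) - corner_functional (\<Delta> y * w)"
      using w(1) by (simp add: d_def left_diff_distrib f_diff cl)
    also have "\<dots> = 0"
      using w(1) by (simp add: by_parts[OF fp _ w] distrib_left distrib_right f_add cl)
    finally have "corner_functional (d * w) = 0" .
    moreover have "corner_functional (d * w) = corner_functional (d * e * star d)"
      using dA e f_right[of "d * e * star d"] by (simp add: w_def closed_intros mult.assoc)
    ultimately show "e * d * e = 0"
      using dA by (intro f_faithful) auto
  qed
  then show ?thesis
    by (simp add: d_def algebra_simps)
qed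

text \<open>Here, as in the Jordan identity below, only \<open>x\<close> and one element determined
  by \<open>x\<close> occur, so a single derivation covers both sides.\<close>

lemma homogeneous:
  assumes "x \<in> A" shows "\<Delta> (cc c * x) = cc c * \<Delta> x"
proof -
  obtain D where D: "vn_derivation A C D" "\<Delta> x = D x" "\<Delta> (cc c * x) = D (cc c * x)"
    using two_local[of x "cc c * x"] assms by (auto simp: closed_intros)
  then show ?thesis
    using assms by (simp add: vn_derivation.D_cc)
qed

lemma jordan:
  assumes "x \<in> A" shows "\<Delta> (x * x) = \<Delta> x * x + x * \<Delta> x"
proof -
  obtain D where D: "vn_derivation A C D" "\<Delta> x = D x" "\<Delta> (x * x) = D (x * x)"
    using two_local[of x "x * x"] assms by (auto simp: closed_intros)
  then show ?thesis
    using assms by (simp add: vn_derivation.D_mult)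
qed

text \<open>Testing with \<open>z = star x\<close> gives \<open>x * star x * x = 0\<close>, so the
  self-adjoint element \<open>star x * x\<close> has square zero; an operator \<open>T\<close> with
  \<open>star T * T = 0\<close> vanishes, and this is used twice.\<close>

sublocale semiprime_subring A
proof
  fix x assume x: "x \<in> A" and z: "\<And>z. z \<in> A \<Longrightarrow> x * z * x = 0"
  have "star (star x * x) * (star x * x) = star x * (x * star x * x)"
    by (simp add: mult.assoc)
  also have "\<dots> = 0"
    using z[of "star x"] x by (simp add: closed_intros)
  finally show "x = 0"
    by (simp only: star_mult_self_eq_0)
qed (auto simp: closed_intros intro!: bexI[of _ 1])

theorem leibniz:
  "x \<in> A \<Longrightarrow> y \<in> A \<Longrightarrow> \<Delta> (x * y) = \<Delta> x * y + x * \<Delta> y"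
  by (rule jordan_derivation_is_derivation[OF map_closed additive jordan])

end

section \<open>Transfer to the algebra of the theorem\<close>

lemma blf_Cop_M:
  assumes "von_neumann_algebra M" "T \<in> M" shows "blf (Cop T) = T"
  using assms unfolding von_neumann_algebra_def by (subst Cop_inverse) blast+

theorem mainTheorem1:
  fixes M :: "('a::chilbert_space \<Rightarrow>\<^sub>L 'a) set"
    and \<Delta> :: "('a \<Rightarrow>\<^sub>L 'a) \<Rightarrow> ('a \<Rightarrow>\<^sub>L 'a)"
  assumes "semifinite_von_neumann_algebra M"
    and "two_local_derivation_on M \<Delta>"
  shows "derivation_on M \<Delta>"
proof -
  have vn: "von_neumann_algebra M"
    using assms(1) by (simp add: semifinite_von_neumann_algebra_def)
  obtain \<tau> where \<tau>: "is_trace M \<tau>" "faithful_trace M \<tau>" "semifinite_trace M \<tau>"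
    using assms(1) by (auto simp: semifinite_von_neumann_algebra_def)
  \<comment> \<open>Each member of \<open>M\<close> has an adjoint in \<open>M\<close>, so
    \<open>Cop\<close> and \<open>blf\<close> are mutually inverse between \<open>M\<close> and
    \<open>A\<close>, and all structure is carried along them.\<close>
  define A where "A = {T. blf T \<in> M}"
  \<comment> \<open>With this choice the bicommutant condition on \<open>M\<close> becomes the axiom
    \<open>mem_iff\<close>.\<close>
  define C where "C = commutant M"
  note blf_Cop = blf_Cop_M[OF vn]
  have CopA: "Cop T \<in> A" if "T \<in> M" for T
    using that blf_Cop[OF that] by (simp add: A_def)
  have blfM: "blf T \<in> M" if "T \<in> A" for T
    using that by (simp add: A_def)
  have MC: "commutant C = M" "M \<subseteq> bounded_ops"
    using vn by (simp_all add: von_neumann_algebra_def C_def)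
  have pos_iff: "positive_op (blf T) \<longleftrightarrow> pos T" for T :: "'a cop"
    by (simp add: positive_op_def pos_def ap_def)
  have positive_part_iff: "T \<in> positive_part M \<longleftrightarrow> T \<in> M \<and> pos (Cop T)" for T
    using blf_Cop[of T] pos_iff[of "Cop T"] by (auto simp: positive_part_def)
  have positive_part_blf: "blf T \<in> positive_part M" if "T \<in> A" "pos T" for T
    using that by (simp add: positive_part_def A_def pos_iff)
  have Cop_add: "Cop (S + T) = Cop S + Cop T" if "S \<in> M" "T \<in> M" for S T
    using that by (metis blf_Cop blf_inverse plus_cop.rep_eq)
  have Cop_mult: "Cop (S o\<^sub>L T) = Cop S * Cop T" if "S \<in> M" "T \<in> M" for S T
    using that by (metis blf_Cop blf_inverse times_cop.rep_eq)
  have blf_cc: "blf (cc c * T) = scaleC_op c (blf T)" for c and T :: "'a cop"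
    by (rule blinfun_eqI) (simp add: times_cop.rep_eq cc.rep_eq scaleC_op.rep_eq)
  have Cop_scaleC: "Cop (scaleC_op c T) = cc c * Cop T" if "T \<in> M" for c T
    using that by (metis blf_Cop blf_inverse blf_cc)
  interpret vn_algebra A C
  proof
    show "C \<subseteq> bounded_ops"
      by (auto simp: C_def commutant_def)
    show "T \<in> A \<longleftrightarrow> (\<forall>S\<in>C. \<forall>x. S (T \<cdot> x) = T \<cdot> S x)" for T
    proof -
      have "blf T \<in> bounded_ops"
        using blf[of T] by auto
      then have "blf T \<in> commutant C \<longleftrightarrow> (\<forall>S\<in>C. \<forall>x. S (T \<cdot> x) = T \<cdot> S x)"
        unfolding mem_commutant_iff ap_def by metis
      then show ?thesis
        by (simp add: A_def MC)
    qed
    show "star T \<in> A" if T: "T \<in> A" for T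
    proof -
      obtain S where "S \<in> M" "is_adjoint (blf T) S"
        using vn blfM[OF T] by (auto simp: von_neumann_algebra_def)
      then have "blf (star T) = S"
        using is_adjoint_star is_adjoint_unique by blast
      then show ?thesis
        using \<open>S \<in> M\<close> by (simp add: A_def)
    qed
  qed
  define t where "t T = \<tau> (blf T)" for T
  define \<Phi> where "\<Phi> T = Cop (\<Delta> (blf T))" for T
  interpret vn_trace A C t
  proof
    show "t (S + T) = t S + t T" if "S \<in> A" "T \<in> A" "pos S" "pos T" for S T
      using \<tau>(1) that positive_part_blf by (simp add: is_trace_def t_def plus_cop.rep_eq)
    show "t (r *\<^sub>R T) = ennreal r * t T" if "T \<in> A" "pos T" "r \<ge> 0" for r T
      using \<tau>(1) that positive_part_blf by (simp add: is_trace_def t_def scaleR_cop.rep_eq)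
    show "t (star T * T) = t (T * star T)" if "T \<in> A" for T
      using \<tau>(1) that is_adjoint_star[of T] blfM star_closed
      by (simp add: is_trace_def t_def times_cop.rep_eq)
    show "T = 0" if "T \<in> A" "pos T" "t T = 0" for T
    proof -
      have "blf T = 0"
        using \<tau>(2) that positive_part_blf by (simp add: faithful_trace_def t_def)
      then show ?thesis
        by (metis blf_inject zero_cop.rep_eq)
    qed
    show "\<exists>S\<in>A. pos S \<and> S \<noteq> 0 \<and> pos (T - S) \<and> t S < \<infinity>" if T: "T \<in> A" "pos T" "T \<noteq> 0" for T
    proof -
      have "blf T \<noteq> 0"
        using T by (metis blf_inject zero_cop.rep_eq)
      then obtain S where S: "S \<in> positive_part M" "S \<noteq> 0" "op_le S (blf T)" "\<tau> S < \<infinity>"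
        using \<tau>(3) positive_part_blf[OF T(1,2)] unfolding semifinite_trace_def by blast
      then have SM: "S \<in> M" "pos (Cop S)"
        by (simp_all add: positive_part_iff)
      have "pos (T - Cop S)"
        using S(3) SM by (simp add: op_le_def blf_Cop minus_cop.rep_eq flip: pos_iff)
      moreover have "Cop S \<noteq> 0"
        using S(2) SM blf_Cop by (metis zero_cop.rep_eq)
      ultimately show ?thesis
        using S(4) SM CopA blf_Cop by (intro bexI[of _ "Cop S"]) (auto simp: t_def)
    qed
  qed
  interpret two_local_derivation A C t \<Phi>
  proof
    fix x y assume xy: "x \<in> A" "y \<in> A"
    then obtain D where D: "derivation_on M D" "\<Delta> (blf x) = D (blf x)" "\<Delta> (blf y) = D (blf y)"
      using assms(2) blfM unfolding two_local_derivation_on_def by blast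
    have DM: "D T \<in> M" if "T \<in> M" for T
      using D(1) that by (auto simp: derivation_on_def)
    have "vn_derivation A C (\<lambda>T. Cop (D (blf T)))"
    proof
      show "Cop (D (blf x)) \<in> A" if "x \<in> A" for x
        using that by (intro CopA DM blfM)
      show "Cop (D (blf (x + y))) = Cop (D (blf x)) + Cop (D (blf y))" if "x \<in> A" "y \<in> A" for x y
        using D(1) that blfM DM by (simp add: derivation_on_def plus_cop.rep_eq Cop_add)
      show "Cop (D (blf (cc c * x))) = cc c * Cop (D (blf x))" if "x \<in> A" for c x
        using D(1) that blfM DM by (simp add: derivation_on_def blf_cc Cop_scaleC)
      show "Cop (D (blf (x * y))) = Cop (D (blf x)) * y + x * Cop (D (blf y))"
        if "x \<in> A" "y \<in> A" for x y
        using D(1) that blfM DM von_neumann_algebra_subalgebra(3)[OF vn]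
        by (simp add: derivation_on_def times_cop.rep_eq Cop_add Cop_mult blf_inverse)
    qed
    then show "\<exists>D. vn_derivation A C D \<and> \<Phi> x = D x \<and> \<Phi> y = D y"
      using D(2,3) by (intro exI[of _ "\<lambda>T. Cop (D (blf T))"]) (simp add: \<Phi>_def)
  qed
  have \<Delta>M: "\<Delta> T \<in> M" if "T \<in> M" for T
    using assms(2) that by (auto simp: two_local_derivation_on_def)
  have \<Delta>: "\<Delta> T = blf (\<Phi> (Cop T))" if "T \<in> M" for T
    using that \<Delta>M by (simp add: \<Phi>_def blf_Cop)
  note sub = von_neumann_algebra_subalgebra[OF vn]
  show ?thesis
    unfolding derivation_on_def
  proof (intro conjI ballI allI)
    show "\<Delta> \<in> M \<rightarrow> M"
      using \<Delta>M by auto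
    show "\<Delta> (x + y) = \<Delta> x + \<Delta> y" if "x \<in> M" "y \<in> M" for x y
      using that additive[of "Cop x" "Cop y"] CopA
      by (simp add: \<Delta> sub Cop_add plus_cop.rep_eq)
    show "\<Delta> (scaleC_op c x) = scaleC_op c (\<Delta> x)" if "x \<in> M" for c x
      using that homogeneous[of "Cop x" c] CopA
      by (simp add: \<Delta> sub Cop_scaleC blf_cc)
    show "\<Delta> (x o\<^sub>L y) = (\<Delta> x o\<^sub>L y) + (x o\<^sub>L \<Delta> y)" if "x \<in> M" "y \<in> M" for x y
      using that leibniz[of "Cop x" "Cop y"] CopA
      by (simp add: \<Delta> sub Cop_mult plus_cop.rep_eq times_cop.rep_eq blf_Cop)
  qed
qed

end
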